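(* Let $L$ be a link with a connected diagram $D$ such that the twist number of $D$ equals the twist number of $L$. Let $G$ be the $\{s,c\}$-colored plane graph associated to $D$, with ordered edges $e_1,\dots,e_k$, $k\ge 1$. For a spanning tree $F$ of $G$ let $p_F$ be the number of edges colored $s$ lying in $F$ plus the number of edges colored $c$ not lying in $F$, and let $p=\max_F p_F$ over all spanning trees $F$ of $G$. Then there is a constant $C>0$ such that for all $t\in\mathbb{Z}^k$, $\|d^{p}\langle D_t\rangle\|<C$. Furthermore, for all $t\in\mathbb{Z}^k$, $$M(\langle D_t\rangle)=M(d^{p}\langle D_t\rangle)<\|d^{p}\langle D_t\rangle\|<C .$$
   Context: Mahler measure of a Laurent polynomial $f\in\mathbb{C}[A^{\pm1}]$: $M(f)=\exp\int_0^1\log|f(e^{2\pi i\theta})|\,d\theta$. $\|f\|$ is the $L^2$ norm of $f$ on the unit circle (the square root of the sum of squared absolute values of the coefficients). Kauffman bracket: $\langle\cdot\rangle\in\mathbb{Z}[A^{\pm1}]$ is defined on link diagrams by $\langle n \text{ disjoint simple closed curves}\rangle=d^{n-1}$ with $d=-A^{-2}-A^{2}$, and $\langle D\rangle=A\langle D_+\rangle+A^{-1}\langle D_-\rangle$, where $D_+$, $D_-$ are the positive ($A$-) and negative ($A^{-1}$-) smoothings of $D$ at a crossing. Twist number: two crossings of a diagram are twist equivalent if some circle in the projection plane meets the diagram at exactly these two crossings. The number of equivalence classes is the twist number of the diagram; the twist number of a link is the minimum over its diagrams. Diagrams $D$ are taken reduced with respect to Reidemeister moves I and II, and (after flypes)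 such that twist equivalent crossings are connected by a chain of bigons. Signed graph of a diagram: checkerboard color the plane with the unbounded region unshaded; vertices are shaded regions, edges are crossings (joining the shaded regions meeting there). An edge is positive if the positive smoothing of its crossing merges the two shaded regions there, and negative otherwise. Conversely a signed plane graph determines a link diagram. Chains and sheafs: a chain is a path of edges whose interior vertices have degree 2 and whose extreme vertices have degree greater than 2 or equal to 1; a sheaf is a collection of edges joining the same two vertices. The length is the sum of the signs of the edges. In the signed graph of $D$ every edge lies in a chain or a sheaf with all edges of the same sign; a crossing alone in its twist class may be taken as a chain or a sheaf of length $\pm1$. The colored graph $G$ of $D$: replace each chain by a single edge colored $c$ and each sheaf by a single edge colored $s$. The number $k$ of edges of $G$ is the twist number of $D$. The diagrams $D_t$: given a plane graph $G$ with edges $e_1,\dots,e_k$ colored by $s$ or $c$, and $t\in\mathbb{Z}^k$, replace each $e_i$ colored $c$ by a chain of $|t_i|$ edges of sign $\mathrm{sgn}(t_i)$, and each $e_i$ colored $s$ by a sheaf of $|t_i|$ parallel edges of sign $\mathrm{sgn}(t_i)$. $D_t$ is the link diagram of the resulting signed plane graph. If $t_i=0$, the corresponding place of the diagram is filled with no crossings, by the smoothing that merges the two shaded regions (color $c$) or separates them (color $s$). *)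

theory Defs
  imports
    "HOL-Analysis.Analysis"
    "HOL-Combinatorics.Orbits"
    "HOL-Library.Multiset"
    "HOL-Library.Poly_Mapping"
begin

section \<open>Laurent polynomials, Mahler measure and norm\<close>

text \<open>The ring \<open>R[A, A\<inverse>]\<close> is the monoid algebra of the additive group of integers.\<close>

type_synonym 'r laurent = "int \<Rightarrow>\<^sub>0 'r"

definition laurent_eval :: "complex laurent \<Rightarrow> complex \<Rightarrow> complex" where
  "laurent_eval f z = (\<Sum>n\<in>Poly_Mapping.keys f. Poly_Mapping.lookup f n * z powi n)"

text \<open>For the zero polynomial the integrand is constantly \<open>-\<infinity>\<close>, so its Mahler measure is \<open>0\<close>;
  for \<open>f \<noteq> 0\<close> the integrand has finitely many logarithmic singularities, where \<open>ln 0 = 0\<close>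
  does not affect the integral.\<close>

definition mahler_measure :: "complex laurent \<Rightarrow> real" where
  "mahler_measure f =
     (if f = 0 then 0
      else exp (integral {0..1} (\<lambda>\<theta>. ln (cmod (laurent_eval f (exp (2 * of_real pi * \<i> * of_real \<theta>)))))))"

definition l2_norm :: "complex laurent \<Rightarrow> real" where
  "l2_norm f = sqrt (\<Sum>n\<in>Poly_Mapping.keys f. (cmod (Poly_Mapping.lookup f n))\<^sup>2)"

definition complex_laurent :: "int laurent \<Rightarrow> complex laurent" where
  "complex_laurent f = Poly_Mapping.map of_int f"

definition var_A :: "int laurent" where
  "var_A = Poly_Mapping.single 1 1"

definition var_A_inv :: "int laurent" where
  "var_A_inv = Poly_Mapping.single (-1) 1"

definition loop_d :: "int laurent" where
  "loop_d = - (var_A_inv ^ 2) - var_A ^ 2"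


section \<open>Combinatorial maps\<close>

text \<open>A graph drawn on a sphere is encoded by its darts (half-edges), the involution exchanging
  the two darts of an edge, and the permutation \<open>rot\<close> sending a dart to the next dart
  counterclockwise around its vertex. The dart \<open>h\<close> also names the corner between \<open>h\<close>
  and \<open>rot h\<close>; \<open>next_corner\<close> walks around the face containing that corner.
  There are no isolated vertices.\<close>

record 'd cmap =
  darts :: "'d set"
  edge :: "'d \<Rightarrow> 'd"
  rot :: "'d \<Rightarrow> 'd"

definition vertex :: "('d, 'm) cmap_scheme \<Rightarrow> 'd \<Rightarrow> 'd set" where
  "vertex M h = orbit (rot M) h"

definition next_corner :: "('d, 'm) cmap_scheme \<Rightarrow> 'd \<Rightarrow> 'd" where
  "next_corner M h = edge M (rot M h)"

definition face :: "('d, 'm) cmap_scheme \<Rightarrow> 'd \<Rightarrow> 'd set" where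
  "face M h = orbit (next_corner M) h"

definition component :: "('d, 'm) cmap_scheme \<Rightarrow> 'd \<Rightarrow> 'd set" where
  "component M h =
     ({(x, edge M x) | x. x \<in> darts M} \<union> {(x, rot M x) | x. x \<in> darts M})\<^sup>* `` {h}"

definition connected_map :: "('d, 'm) cmap_scheme \<Rightarrow> bool" where
  "connected_map M \<longleftrightarrow> (\<forall>h\<in>darts M. component M h = darts M)"

text \<open>Euler's formula, summed over the components: every component has genus \<open>0\<close>.\<close>

definition planar_map :: "('d, 'm) cmap_scheme \<Rightarrow> bool" where
  "planar_map M \<longleftrightarrow>
     card (vertex M ` darts M) + card (face M ` darts M)
       = card ((\<lambda>h. {h, edge M h}) ` darts M) + 2 * card (component M ` darts M)"


section \<open>Link diagrams\<close>

text \<open>A diagram is a planar diagram code. \<open>Crossing a b c d\<close> is a crossing whose four ends,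
  listed counterclockwise, carry the labels \<open>a, b, c, d\<close>; the strand \<open>a\<close>--\<open>c\<close> passes under
  the strand \<open>b\<close>--\<open>d\<close>. \<open>Arc a b\<close> is a piece of strand without crossing; in particular
  \<open>Arc a a\<close> is a simple closed curve. Ends carrying the same label are joined. The code
  determines each component of the diagram on the sphere. It does not record how several components
  lie in each other's regions, on which neither the bracket nor the link depends.\<close>

datatype 'a node = Crossing 'a 'a 'a 'a | Arc 'a 'a

type_synonym 'a diagram = "'a node list"

fun slots :: "'a node \<Rightarrow> 'a list" where
  "slots (Crossing a b c d) = [a, b, c, d]"
| "slots (Arc a b) = [a, b]"

fun is_crossing :: "'a node \<Rightarrow> bool" where
  "is_crossing (Crossing a b c d) = True"
| "is_crossing (Arc a b) = False"

definition half_edges :: "'a diagram \<Rightarrow> (nat \<times> nat) set" where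
  "half_edges D = {(j, i). j < length D \<and> i < length (slots (D ! j))}"

definition label :: "'a diagram \<Rightarrow> nat \<times> nat \<Rightarrow> 'a" where
  "label D = (\<lambda>(j, i). slots (D ! j) ! i)"

definition other_end :: "'a diagram \<Rightarrow> nat \<times> nat \<Rightarrow> nat \<times> nat" where
  "other_end D h = (THE h'. h' \<in> half_edges D \<and> h' \<noteq> h \<and> label D h' = label D h)"

definition diagram_map :: "'a diagram \<Rightarrow> (nat \<times> nat) cmap" where
  "diagram_map D =
     \<lparr> darts = half_edges D,
       edge = other_end D,
       rot = (\<lambda>(j, i). (j, Suc i mod length (slots (D ! j)))) \<rparr>"

definition link_diagram :: "'a diagram \<Rightarrow> bool" where
  "link_diagram D \<longleftrightarrow>
     D \<noteq> [] \<and>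
     (\<forall>h\<in>half_edges D. \<exists>!h'. h' \<in> half_edges D \<and> h' \<noteq> h \<and> label D h' = label D h) \<and>
     planar_map (diagram_map D)"


section \<open>Kauffman bracket\<close>

definition num_circles :: "('a \<times> 'a) list \<Rightarrow> nat" where
  "num_circles ps =
     card ((\<lambda>a. (set ps \<union> (set ps)\<inverse>)\<^sup>* `` {a}) ` (fst ` set ps \<union> snd ` set ps))"

text \<open>The first argument collects the crossingless strands obtained so far. Turning the
  over-strand \<open>b\<close>--\<open>d\<close> counterclockwise sweeps out the regions between \<open>b\<close> and \<open>c\<close> and
  between \<open>d\<close> and \<open>a\<close>; the positive smoothing merges these two.\<close>

fun bracket_rec :: "('a \<times> 'a) list \<Rightarrow> 'a diagram \<Rightarrow> int laurent" where
  "bracket_rec ps [] = loop_d ^ (num_circles ps - 1)"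
| "bracket_rec ps (Arc a b # D) = bracket_rec ((a, b) # ps) D"
| "bracket_rec ps (Crossing a b c d # D) =
     var_A * bracket_rec ((a, b) # (c, d) # ps) D
     + var_A_inv * bracket_rec ((a, d) # (b, c) # ps) D"

definition kauffman_bracket :: "'a diagram \<Rightarrow> int laurent" where
  "kauffman_bracket D = bracket_rec [] D"


section \<open>Links\<close>

text \<open>Links are represented as classes of diagrams under Reidemeister moves. The rules before
  \<open>R1a\<close> only change the encoding of a diagram. In \<open>R2\<close> the strand \<open>x\<close>--\<open>f\<close>--\<open>z\<close> passes twice
  under \<open>y\<close>--\<open>e\<close>--\<open>w\<close>. In the third moves the strand \<open>t\<close> lies above \<open>m\<close>, and \<open>m\<close> above \<open>b\<close>;
  the six outer ends are, counterclockwise, \<open>t0 m0 b0 t2 m2 b2\<close> in \<open>R3a\<close> and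
  \<open>t0 b0 m0 t2 b2 m2\<close> in \<open>R3b\<close>.\<close>

inductive move :: "'a diagram \<Rightarrow> 'a diagram \<Rightarrow> bool" where
  reorder: "mset D = mset D' \<Longrightarrow> move D D'"
| relabel: "inj_on f (\<Union>(set_node ` set D)) \<Longrightarrow> move D (map (map_node f) D)"
| half_turn: "move (Crossing a b c d # D) (Crossing c d a b # D)"
| reverse_arc: "move (Arc a b # D) (Arc b a # D)"
| absorb_arc: "a \<noteq> b \<Longrightarrow> move (Arc a b # D) (map (map_node (\<lambda>x. if x = b then a else x)) D)"
| R1a: "move (Crossing a a b c # D) (Arc b c # D)"
| R1b: "move (Crossing a b b c # D) (Arc a c # D)"
| R2: "move (Crossing f e x y # Crossing z e f w # D) (Arc y w # Arc x z # D)"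
| R3a: "move (Crossing m0 t1 m1 t0 # Crossing b0 t2 b1 t1 # Crossing b1 m2 b2 m1 # D)
             (Crossing m1 t2 m2 t1 # Crossing b1 t1 b2 t0 # Crossing b0 m1 b1 m0 # D)"
| R3b: "move (Crossing b0 t1 b1 t0 # Crossing m0 t2 m1 t1 # Crossing b1 m1 b2 m2 # D)
             (Crossing b1 t2 b2 t1 # Crossing m1 t1 m2 t0 # Crossing b0 m0 b1 m1 # D)"

definition same_link :: "('a diagram \<times> 'a diagram) set" where
  "same_link =
     {(D, D'). link_diagram D \<and> link_diagram D' \<and>
        (D, D') \<in> {(E, E'). link_diagram E \<and> link_diagram E' \<and> (move E E' \<or> move E' E)}\<^sup>*}"

definition links :: "nat diagram set set" where
  "links = {D. link_diagram D} // same_link"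


section \<open>Twist number and reduced diagrams\<close>

definition crossings :: "'a diagram \<Rightarrow> nat set" where
  "crossings D = {j. j < length D \<and> is_crossing (D ! j)}"

text \<open>A circle meeting the diagram in exactly the crossings \<open>p\<close> and \<open>q\<close> passes through opposite
  corners of each of them, and otherwise runs inside the two (possibly equal) regions containing
  these corners. The equivalence relation is the one generated by this relation.\<close>

definition twist_rel :: "'a diagram \<Rightarrow> (nat \<times> nat) set" where
  "twist_rel D =
     {(p, q). p \<in> crossings D \<and> q \<in> crossings D \<and>
        (\<exists>i<4. \<exists>i'<4.
           face (diagram_map D) (p, i) = face (diagram_map D) (q, i') \<and>
           face (diagram_map D) (p, (i + 2) mod 4) = face (diagram_map D) (q, (i' + 2) mod 4))}"

definition twist_classes :: "'a diagram \<Rightarrow> nat set set" where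
  "twist_classes D = crossings D // (twist_rel D)\<^sup>+"

definition twist_number :: "'a diagram \<Rightarrow> nat" where
  "twist_number D = card (twist_classes D)"

definition link_twist_number :: "'a diagram set \<Rightarrow> nat" where
  "link_twist_number L = (LEAST n. \<exists>D\<in>L. twist_number D = n)"

text \<open>Every connected diagram with at least one crossing has a code without \<open>Arc\<close> nodes. The
  following notions are meant for such codes, where the number of corners of a face is the number
  of crossings around it.\<close>

definition arc_free :: "'a diagram \<Rightarrow> bool" where
  "arc_free D \<longleftrightarrow> (\<forall>x\<in>set D. is_crossing x)"

definition bigon_corner :: "'a diagram \<Rightarrow> nat \<times> nat \<Rightarrow> bool" where
  "bigon_corner D h \<longleftrightarrow>
     h \<in> half_edges D \<and> next_corner (diagram_map D) h \<noteq> h \<and>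
     next_corner (diagram_map D) (next_corner (diagram_map D) h) = h"

text \<open>There is no monogon, and no bigon bounded by an over-strand and an under-strand. The latter
  are the bigons whose corners have different parity: going counterclockwise around the crossing,
  an even corner lies between an under-end and an over-end, an odd one the other way round.\<close>

definition reduced_diagram :: "'a diagram \<Rightarrow> bool" where
  "reduced_diagram D \<longleftrightarrow>
     (\<forall>h\<in>half_edges D. next_corner (diagram_map D) h \<noteq> h) \<and>
     (\<forall>h. bigon_corner D h \<longrightarrow> even (snd h) = even (snd (next_corner (diagram_map D) h)))"

definition twist_classes_by_bigons :: "'a diagram \<Rightarrow> bool" where
  "twist_classes_by_bigons D \<longleftrightarrow>
     (\<forall>(p, q)\<in>twist_rel D.
        (p, q) \<in> {(fst h, fst (next_corner (diagram_map D) h)) | h. bigon_corner D h}\<^sup>*)"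


section \<open>The signed graph of a diagram\<close>

text \<open>A checkerboard coloring is given by the set \<open>S\<close> of corners lying in shaded regions. The
  corner \<open>out\<close> lies in the region that is unbounded when the diagram is drawn in the plane.\<close>

definition checkerboard :: "'a diagram \<Rightarrow> nat \<times> nat \<Rightarrow> (nat \<times> nat) set \<Rightarrow> bool" where
  "checkerboard D out S \<longleftrightarrow>
     S \<subseteq> half_edges D \<and> out \<in> half_edges D - S \<and>
     (\<forall>h\<in>S. face (diagram_map D) h \<subseteq> S) \<and>
     (\<forall>h\<in>half_edges D. h \<in> S \<longleftrightarrow> rot (diagram_map D) h \<notin> S)"

record 'd signed_map = "'d cmap" +
  positive :: "'d \<Rightarrow> bool"

text \<open>The darts are the shaded corners: a crossing \<open>j\<close> has two of them, \<open>(j, i)\<close> and \<open>(j, i + 2)\<close>,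
  and is an edge joining the regions containing them. To find the next dart counterclockwise
  around a shaded region, follow the strand at end \<open>i\<close>, keeping the region on the left, and take
  the corner just clockwise of the end where one arrives. The positive smoothing merges the
  regions at corners \<open>1\<close> and \<open>3\<close>.\<close>

definition signed_graph :: "'a diagram \<Rightarrow> (nat \<times> nat) set \<Rightarrow> (nat \<times> nat) signed_map" where
  "signed_graph D S =
     \<lparr> darts = S,
       edge = (\<lambda>(j, i). (j, (i + 2) mod 4)),
       rot = (\<lambda>h. case other_end D h of (j, i) \<Rightarrow> (j, (i + 3) mod 4)),
       positive = (\<lambda>(j, i). odd i) \<rparr>"

text \<open>Chains and sheafs are listed as darts, all oriented the same way: consecutively along the
  path for a chain, counterclockwise around the common initial vertex for a sheaf, so that
  consecutive edges of a sheaf bound a bigon. A chain running once around a graph that is a cycle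
  has coinciding extreme vertices, of degree 2.\<close>

definition chain :: "('d, 'm) cmap_scheme \<Rightarrow> 'd list \<Rightarrow> bool" where
  "chain M xs \<longleftrightarrow>
     xs \<noteq> [] \<and> set xs \<subseteq> darts M \<and> distinct (xs @ map (edge M) xs) \<and>
     (\<forall>n. Suc n < length xs \<longrightarrow>
        vertex M (xs ! Suc n) = {edge M (xs ! n), xs ! Suc n} \<and>
        rot M (edge M (xs ! n)) = xs ! Suc n) \<and>
     (let u = vertex M (hd xs); v = vertex M (edge M (last xs))
      in (card u > 2 \<or> card u = 1) \<and> (card v > 2 \<or> card v = 1) \<or> u = v)"

definition sheaf :: "('d, 'm) cmap_scheme \<Rightarrow> 'd list \<Rightarrow> bool" where
  "sheaf M xs \<longleftrightarrow>
     xs \<noteq> [] \<and> set xs \<subseteq> darts M \<and> distinct (xs @ map (edge M) xs) \<and>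
     (\<forall>n. Suc n < length xs \<longrightarrow>
        rot M (xs ! n) = xs ! Suc n \<and> rot M (edge M (xs ! Suc n)) = edge M (xs ! n))"


section \<open>Colored plane graphs\<close>

datatype color = Col_s | Col_c

text \<open>The edges are numbered \<open>0, \<dots>, k - 1\<close>; the edge \<open>i\<close> consists of the darts \<open>(i, False)\<close> and
  \<open>(i, True)\<close>, and \<open>turn\<close> is the counterclockwise rotation.\<close>

record colored_graph =
  num_edges :: nat
  turn :: "nat \<times> bool \<Rightarrow> nat \<times> bool"
  color :: "nat \<Rightarrow> color"

definition graph_map :: "colored_graph \<Rightarrow> (nat \<times> bool) cmap" where
  "graph_map G =
     \<lparr> darts = {..<num_edges G} \<times> UNIV,
       edge = (\<lambda>(i, b). (i, \<not> b)),
       rot = turn G \<rparr>"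

definition plane_graph :: "colored_graph \<Rightarrow> bool" where
  "plane_graph G \<longleftrightarrow>
     bij_betw (turn G) (darts (graph_map G)) (darts (graph_map G)) \<and>
     connected_map (graph_map G) \<and> planar_map (graph_map G)"

text \<open>When the chain or sheaf \<open>xs\<close> is collapsed to an edge, one end of that edge replaces, at the
  initial (\<open>b = False\<close>) or final (\<open>b = True\<close>) vertex of \<open>xs\<close>, the consecutive darts from
  \<open>first_dart\<close> to \<open>last_dart\<close> counterclockwise.\<close>

definition first_dart :: "('d, 'm) cmap_scheme \<Rightarrow> 'd list \<Rightarrow> bool \<Rightarrow> 'd" where
  "first_dart M xs b = (if b then edge M (last xs) else hd xs)"

definition last_dart :: "('d, 'm) cmap_scheme \<Rightarrow> color \<Rightarrow> 'd list \<Rightarrow> bool \<Rightarrow> 'd" where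
  "last_dart M col xs b =
     (case col of
        Col_c \<Rightarrow> if b then edge M (last xs) else hd xs
      | Col_s \<Rightarrow> if b then edge M (hd xs) else last xs)"

text \<open>\<open>G\<close> arises from the signed graph of \<open>D\<close> by collapsing the chain or sheaf \<open>xs i\<close> formed by
  each twist class to the edge \<open>i\<close>.\<close>

definition colored_graph_of :: "'a diagram \<Rightarrow> (nat \<times> nat) set \<Rightarrow> colored_graph \<Rightarrow> bool" where
  "colored_graph_of D S G \<longleftrightarrow>
     plane_graph G \<and>
     (let M = signed_graph D S in
      \<exists>xs.
        bij_betw (\<lambda>i. fst ` set (xs i)) {..<num_edges G} (twist_classes D) \<and>
        (\<forall>i<num_edges G.
           set (xs i) \<subseteq> darts M \<and>
           (\<forall>h\<in>set (xs i). \<forall>h'\<in>set (xs i). positive M h = positive M h') \<and>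
           (length (xs i) = 1 \<or>
            (case color G i of Col_c \<Rightarrow> chain M (xs i) | Col_s \<Rightarrow> sheaf M (xs i)))) \<and>
        (\<forall>(i, b)\<in>darts (graph_map G).
           rot M (last_dart M (color G i) (xs i) b)
             = (case turn G (i, b) of (i', b') \<Rightarrow> first_dart M (xs i') b')))"

definition joined :: "colored_graph \<Rightarrow> nat set \<Rightarrow> ((nat \<times> bool) set \<times> (nat \<times> bool) set) set" where
  "joined G F = {(vertex (graph_map G) (i, b), vertex (graph_map G) (i, \<not> b)) | i b. i \<in> F}\<^sup>*"

text \<open>An edge lies on a cycle in \<open>F\<close> iff its ends remain joined when it is removed from \<open>F\<close>.\<close>

definition spanning_tree :: "colored_graph \<Rightarrow> nat set \<Rightarrow> bool" where
  "spanning_tree G F \<longleftrightarrow>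
     F \<subseteq> {..<num_edges G} \<and>
     (\<forall>x\<in>darts (graph_map G). \<forall>y\<in>darts (graph_map G).
        (vertex (graph_map G) x, vertex (graph_map G) y) \<in> joined G F) \<and>
     (\<forall>i\<in>F. (vertex (graph_map G) (i, False), vertex (graph_map G) (i, True)) \<notin> joined G (F - {i}))"

definition tree_weight :: "colored_graph \<Rightarrow> nat set \<Rightarrow> nat" where
  "tree_weight G F =
     card {i \<in> F. color G i = Col_s} + card {i \<in> {..<num_edges G} - F. color G i = Col_c}"


section \<open>The twisted diagrams\<close>

text \<open>In the link diagram of a plane graph, an edge becomes a tangle with four ends: \<open>Lft z\<close> and
  \<open>Rgt z\<close> are the ends to the left and to the right of the dart \<open>z\<close>, seen from the vertex of \<open>z\<close>.
  Across the corner following \<open>z\<close>, the end \<open>Lft z\<close> is joined to \<open>Rgt (turn G z)\<close>.\<close>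

datatype strand_label = Lft "nat \<times> bool" | Rgt "nat \<times> bool" | Inner nat nat bool

text \<open>A crossing on an edge drawn from west to east, so that the shaded regions are west and east.\<close>

definition signed_crossing :: "bool \<Rightarrow> 'a \<Rightarrow> 'a \<Rightarrow> 'a \<Rightarrow> 'a \<Rightarrow> 'a node" where
  "signed_crossing pos nw sw se ne =
     (if pos then Crossing ne nw sw se else Crossing nw sw se ne)"

text \<open>The initial vertex of the edge is in the west. A chain is built from west to east with
  \<open>Inner i j True\<close> in the north and \<open>Inner i j False\<close> in the south; a sheaf is built from south
  to north with \<open>Inner i j True\<close> in the west and \<open>Inner i j False\<close> in the east. Without
  crossings, the arcs form the smoothing merging, respectively separating, the two regions.\<close>

definition chain_tangle :: "nat \<Rightarrow> int \<Rightarrow> strand_label diagram" where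
  "chain_tangle i t =
     (let n = nat \<bar>t\<bar> in
       [Arc (Lft (i, False)) (Inner i 0 True), Arc (Rgt (i, False)) (Inner i 0 False),
        Arc (Lft (i, True)) (Inner i n False), Arc (Rgt (i, True)) (Inner i n True)]
       @ map (\<lambda>j. signed_crossing (t > 0)
                (Inner i j True) (Inner i j False) (Inner i (Suc j) False) (Inner i (Suc j) True))
           [0..<n])"

definition sheaf_tangle :: "nat \<Rightarrow> int \<Rightarrow> strand_label diagram" where
  "sheaf_tangle i t =
     (let n = nat \<bar>t\<bar> in
       [Arc (Rgt (i, False)) (Inner i 0 True), Arc (Lft (i, True)) (Inner i 0 False),
        Arc (Lft (i, False)) (Inner i n True), Arc (Rgt (i, True)) (Inner i n False)]
       @ map (\<lambda>j. signed_crossing (t > 0)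
                (Inner i (Suc j) True) (Inner i j True) (Inner i j False) (Inner i (Suc j) False))
           [0..<n])"

definition twisted_diagram :: "colored_graph \<Rightarrow> (nat \<Rightarrow> int) \<Rightarrow> strand_label diagram" where
  "twisted_diagram G t =
     concat (map (\<lambda>i. case color G i of Col_c \<Rightarrow> chain_tangle i (t i) | Col_s \<Rightarrow> sheaf_tangle i (t i))
       [0..<num_edges G])
     @ map (\<lambda>z. Arc (Lft z) (Rgt (turn G z))) (List.product [0..<num_edges G] [False, True])"

end

theory Submission
  imports Defs "HOL-Computational_Algebra.Fundamental_Theorem_Algebra"
begin

text \<open>Resolving all crossings of \<open>D\<^sub>t\<close> edge by edge expresses the bracket as a sum over edge sets
  \<open>F\<close> of \<open>G\<close> (the edges whose shaded regions are merged). For each edge one of the two resolutions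
  has a unit as coefficient and the other one a quotient by \<open>d\<close> of a difference of two units, whatever
  the number of crossings is. The edges of the second kind are counted by the weight of \<open>F\<close>, so the
  term of \<open>F\<close> has the power \<open>c - 1 - weight\<close> of \<open>d\<close> with \<open>c\<close> the number of circles of the state.

  If \<open>c > 1\<close>, some edge meets two circles, and changing its resolution merges them while
  the weight changes by one. Thus the weight of \<open>F\<close> exceeds that of a state with a single circle by at
  most \<open>c - 1\<close>. By Euler's formula a single-circle state is a spanning tree: \<open>F\<close> connects the vertices,
  and the complement connects the faces of \<open>G\<close>. Hence \<open>d\<^sup>p\<close> clears all denominators and the
  coefficients are bounded independently of \<open>t\<close>.

  The strict inequality needs \<open>p \<ge> 1\<close>, so that \<open>d\<^sup>p \<langle>D\<^sub>t\<rangle>\<close> has a zero on the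
  unit circle. If \<open>p = 0\<close>, the state of maximal weight has more circles than \<open>G\<close> has edges,
  so one of its circles passes a single edge, which is a monogon of \<open>D\<close>.\<close>

section \<open>Components of strands\<close>

text \<open>The denominators come from iterating one twist. Adding a crossing to the row of an edge
  acts on the two smoothings of the row by a triangular matrix. Its diagonal entries are \<alpha>
  and \<gamma> = \<alpha> + \<beta> d, its off-diagonal entry is \<beta>, and \<alpha>, \<beta> are
  A and its inverse in some order. The n-th power has the off-diagonal entry (\<gamma>^n -
  \<alpha>^n) / d, and \<gamma> is again a unit. Uniformity in \<open>t\<close> rests on the fact
  that n enters only through exponents of units: the sum of the absolute values of the coefficients
  of such a unit is 1 whatever the exponent. This sum is submultiplicative and dominates the L2
  norm. Circles are classes of strand labels, and statements that would be drawn with curves become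
  counts of labels; planarity enters through Euler's formula. A single unit has equal Mahler measure
  and norm, and for the zero polynomial both are 0. Strictness therefore asks for a zero on the
  circle and for a nonvanishing bracket.\<close>

definition conn :: "('a \<times> 'a) set \<Rightarrow> ('a \<times> 'a) set" where
  "conn R = (R \<union> R\<inverse>)\<^sup>*"

lemma conn_refl [simp]: "(x, x) \<in> conn R"
  by (simp add: conn_def)

lemma conn_sym: "(x, y) \<in> conn R \<Longrightarrow> (y, x) \<in> conn R"
  unfolding conn_def by (rule symD[OF sym_rtrancl]) (auto simp: sym_def)

lemma conn_trans: "(x, y) \<in> conn R \<Longrightarrow> (y, z) \<in> conn R \<Longrightarrow> (x, z) \<in> conn R"
  unfolding conn_def by (rule rtrancl_trans)

lemma conn_pair: "(x, y) \<in> R \<Longrightarrow> (x, y) \<in> conn R"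
  unfolding conn_def by auto

lemma conn_image:
  assumes "(x, y) \<in> conn R" "\<And>a b. (a, b) \<in> R \<Longrightarrow> (f a, f b) \<in> conn Q"
  shows "(f x, f y) \<in> conn Q"
  using assms(1) unfolding conn_def[of R]
proof induction
  case (step y z)
  then show ?case using assms(2) conn_sym conn_trans by fast
qed simp

lemma conn_subset:
  assumes "\<And>a b. (a, b) \<in> R \<Longrightarrow> (a, b) \<in> conn Q"
  shows "conn R \<subseteq> conn Q"
  using conn_image[where f = id and R = R and Q = Q] assms by auto

lemma conn_mono: "R \<subseteq> Q \<Longrightarrow> conn R \<subseteq> conn Q"
  by (rule conn_subset) (auto intro: conn_pair)

lemma conn_class_eq_iff: "conn R `` {x} = conn R `` {y} \<longleftrightarrow> (x, y) \<in> conn R"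
  by (auto intro: conn_sym conn_trans)

lemma conn_Field: "(x, y) \<in> conn R \<Longrightarrow> x \<in> Field R \<Longrightarrow> y \<in> Field R"
  unfolding conn_def by (induction rule: rtrancl_induct) (auto simp: Field_def)

text \<open>Contracting one edge removes that edge and at most one vertex, and what was joined stays
  joined. The bound serves for the vertices of \<open>G\<close> and again for its faces.\<close>

lemma card_le_conn:
  assumes "finite R" "finite V" "\<And>x y. x \<in> V \<Longrightarrow> y \<in> V \<Longrightarrow> (x, y) \<in> conn R"
  shows "card V \<le> card R + 1"
  using assms
proof (induction "card R" arbitrary: R V rule: less_induct)
  case less
  show ?case
  proof (cases "R = {}")
    case True
    then have "x = y" if "x \<in> V" "y \<in> V" for x y
      using less.prems(3)[OF that] by (simp add: conn_def)
    then show ?thesis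
      using card_le_Suc0_iff_eq[OF less.prems(2)] by auto
  next
    case False
    then obtain a b where ab: "(a, b) \<in> R" by auto
    define f where "f = (\<lambda>x. if x = b then a else x)"
    define Q where "Q = (\<lambda>(x, y). (f x, f y)) ` (R - {(a, b)})"
    have Q: "card Q < card R"
    proof -
      have "card Q \<le> card (R - {(a, b)})"
        unfolding Q_def by (rule card_image_le) (use less.prems(1) in auto)
      also have "\<dots> < card R"
        by (rule card_Diff1_less[OF less.prems(1) ab])
      finally show ?thesis .
    qed
    have img: "(f x, f y) \<in> conn Q" if "(x, y) \<in> conn R" for x y
    proof (rule conn_image[OF that])
      fix u v assume uv: "(u, v) \<in> R"
      show "(f u, f v) \<in> conn Q"
      proof (cases "(u, v) = (a, b)")
        case True
        then show ?thesis by (simp add: f_def)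
      next
        case False
        with uv show ?thesis
          unfolding Q_def by (intro conn_pair image_eqI[where x = "(u, v)"]) auto
      qed
    qed
    have "card (f ` V) \<le> card Q + 1"
    proof (rule less.hyps[OF Q])
      show "finite Q" using less.prems(1) by (simp add: Q_def)
      show "finite (f ` V)" using less.prems(2) by simp
      show "(x, y) \<in> conn Q" if "x \<in> f ` V" "y \<in> f ` V" for x y
        using that less.prems(3) img by blast
    qed
    moreover have "card V \<le> card (f ` V) + 1"
    proof -
      have "card (V - {b}) \<le> card (f ` V)"
      proof (rule card_mono)
        show "finite (f ` V)" using less.prems(2) by simp
        show "V - {b} \<subseteq> f ` V" by (force simp: f_def)
      qed
      then show ?thesis using less.prems(2) by (auto simp: card_Diff_singleton_if split: if_splits)
    qed
    ultimately show ?thesis using Q by linarith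
  qed
qed

section \<open>Counting the circles formed by strands\<close>

lemma num_circles_conn: "num_circles ps = card ((\<lambda>a. conn (set ps) `` {a}) ` Field (set ps))"
  by (simp add: num_circles_def conn_def Field_def Domain_fst Range_snd)

lemma finite_Field_set [simp]: "finite (Field (set ps))"
  by (auto simp: Field_def Domain_fst Range_snd)

lemma num_circles_set_cong: "set ps = set qs \<Longrightarrow> num_circles ps = num_circles qs"
  by (simp add: num_circles_conn)

lemma num_circles_pos: "ps \<noteq> [] \<Longrightarrow> num_circles ps \<ge> 1"
  by (cases ps) (auto simp: num_circles_conn Suc_le_eq card_gt_0_iff)

text \<open>\<open>f\<close> moves each label along its own circle, so the classes of
  \<open>ps\<close> and those of \<open>qs\<close> determine each other. This is the abstract form
  of shortening strands: inner labels slide to places that survive in \<open>qs\<close>.\<close>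

lemma num_circles_contract:
  assumes "f ` Field (set ps) = Field (set qs)"
    and "\<And>a b. (a, b) \<in> set ps \<Longrightarrow> (f a, f b) \<in> conn (set qs)"
    and "\<And>a b. (a, b) \<in> set qs \<Longrightarrow> (a, b) \<in> conn (set ps)"
    and "\<And>a. a \<in> Field (set ps) \<Longrightarrow> (a, f a) \<in> conn (set ps)"
  shows "num_circles ps = num_circles qs"
proof -
  let ?P = "conn (set ps)" and ?Q = "conn (set qs)"
  have iff: "(a, b) \<in> ?P \<longleftrightarrow> (f a, f b) \<in> ?Q" if "a \<in> Field (set ps)" "b \<in> Field (set ps)" for a b
  proof
    assume "(f a, f b) \<in> ?Q"
    then have "(f a, f b) \<in> ?P" using conn_subset assms(3) by blast
    then show "(a, b) \<in> ?P" using assms(4) that conn_sym conn_trans by metis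
  qed (rule conn_image[where f = f, OF _ assms(2)])
  \<comment> \<open>The union defines the map on classes without a choice of representatives: all
    the classes united coincide.\<close>
  have "bij_betw (\<lambda>X. \<Union> ((\<lambda>a. ?Q `` {f a}) ` X))
    ((\<lambda>a. ?P `` {a}) ` Field (set ps)) ((\<lambda>a. ?Q `` {a}) ` Field (set qs))"
  proof -
    have cl: "\<Union> ((\<lambda>a. ?Q `` {f a}) ` (?P `` {x})) = ?Q `` {f x}" if "x \<in> Field (set ps)" for x
    proof -
      have const: "?Q `` {f y} = ?Q `` {f x}" if "y \<in> ?P `` {x}" for y
        using that conn_class_eq_iff conn_image[where f = f, OF _ assms(2)] conn_sym
        by (metis Image_singleton_iff)
      have "?P `` {x} \<noteq> {}" using conn_refl by fast
      then show ?thesis by (rule SUP_eq_const) (rule const)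
    qed
    have im: "(\<lambda>a. ?Q `` {a}) ` Field (set qs) = (\<lambda>a. ?Q `` {f a}) ` Field (set ps)"
      unfolding assms(1)[symmetric] by (simp only: image_image)
    show ?thesis
      unfolding im
    proof (rule bij_betw_imageI)
      show "inj_on (\<lambda>X. \<Union> ((\<lambda>a. ?Q `` {f a}) ` X)) ((\<lambda>a. ?P `` {a}) ` Field (set ps))"
      proof (rule inj_onI, elim imageE, hypsubst)
        fix x y assume "x \<in> Field (set ps)" "y \<in> Field (set ps)"
          and "\<Union> ((\<lambda>a. ?Q `` {f a}) ` (?P `` {x})) = \<Union> ((\<lambda>a. ?Q `` {f a}) ` (?P `` {y}))"
        then show "?P `` {x} = ?P `` {y}"
          by (simp only: cl conn_class_eq_iff iff)
      qed
      show "(\<lambda>X. \<Union> ((\<lambda>a. ?Q `` {f a}) ` X)) ` (\<lambda>a. ?P `` {a}) ` Field (set ps)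
          = (\<lambda>a. ?Q `` {f a}) ` Field (set ps)"
        unfolding image_image by (rule image_cong[OF refl]) (rule cl)
    qed
  qed
  then show ?thesis unfolding num_circles_conn by (rule bij_betw_same_card)
qed

lemma num_circles_loop:
  assumes "x \<notin> Field (set ps)" "y \<notin> Field (set ps)"
  shows "num_circles ((x, y) # ps) = num_circles ps + 1"
proof -
  let ?P = "conn (set ps)" and ?Q = "conn (set ((x, y) # ps))"
  have sub: "?P \<subseteq> ?Q" by (rule conn_mono) auto
  have same: "?Q `` {a} = ?P `` {a}" if a: "a \<in> Field (set ps)" for a
  proof -
    have "(a, b) \<in> ?P" if "(a, b) \<in> ?Q" for b
      using that unfolding conn_def[of "set ((x, y) # ps)"]
    proof induction
      case (step b c)
      then have "b \<in> Field (set ps)" using conn_Field a by metis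
      then have "(b, c) \<in> ?P"
        using step assms by (auto simp: FieldI1 FieldI2 intro: conn_pair conn_sym)
      with step show ?case by (metis conn_trans)
    qed simp
    then show ?thesis using sub by blast
  qed
  have eq: "?Q `` {y} = ?Q `` {x}"
    unfolding conn_class_eq_iff by (rule conn_sym, rule conn_pair) simp
  have new: "?Q `` {x} \<notin> (\<lambda>a. ?P `` {a}) ` Field (set ps)"
  proof
    assume "?Q `` {x} \<in> (\<lambda>a. ?P `` {a}) ` Field (set ps)"
    then obtain a where "a \<in> Field (set ps)" "?Q `` {x} = ?P `` {a}" by auto
    then have "(a, x) \<in> ?P" by (metis Image_singleton_iff conn_refl)
    then show False using \<open>a \<in> _\<close> conn_Field assms by metis
  qed
  have "Field (set ((x, y) # ps)) = insert x (insert y (Field (set ps)))"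
    by (auto simp: Field_def)
  then have "(\<lambda>a. ?Q `` {a}) ` Field (set ((x, y) # ps))
      = insert (?Q `` {x}) ((\<lambda>a. ?P `` {a}) ` Field (set ps))"
    by (simp only: image_insert image_cong[OF refl same] eq insert_absorb2)
  then show ?thesis using new by (simp add: num_circles_conn)
qed

section \<open>Resolving the crossings of an edge\<close>

abbreviation node_labels :: "'a diagram \<Rightarrow> 'a set" where
  "node_labels D \<equiv> \<Union> (set_node ` set D)"

text \<open>The list \<open>qs\<close> stands for the strands that resolving \<open>D\<close>
  contributes, so the comparison holds in every state and can be summed. The side condition guards
  the truncated exponent \<open>num_circles ps - 1\<close>: a count of 0 for \<open>ps'\<close>
  would give the right-hand side one factor d too many.\<close>

lemma bracket_rec_loops:
  assumes "\<And>qs. Field (set qs) \<subseteq> node_labels D \<Longrightarrow>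
      num_circles (qs @ ps) = m + num_circles (qs @ ps')"
    and "m = 0 \<or> ps' \<noteq> []"
  shows "bracket_rec ps D = loop_d ^ m * bracket_rec ps' D"
  using assms
proof (induction D arbitrary: ps ps')
  case Nil
  have "num_circles ps - 1 = m + (num_circles ps' - 1)"
    using Nil.prems(1)[of "[]"] Nil.prems(2) num_circles_pos[of ps'] by auto
  then show ?case by (simp add: power_add)
next
  case (Cons X D)
  have step: "bracket_rec (rs @ ps) D = loop_d ^ m * bracket_rec (rs @ ps') D"
    if "Field (set rs) \<subseteq> set_node X" for rs
  proof (rule Cons.IH)
    fix qs :: "('a \<times> 'a) list"
    assume "Field (set qs) \<subseteq> node_labels D"
    then have "Field (set (qs @ rs)) \<subseteq> node_labels (X # D)" using that by (auto simp: Field_def)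
    from Cons.prems(1)[OF this]
    show "num_circles (qs @ rs @ ps) = m + num_circles (qs @ rs @ ps')" by simp
  qed (use Cons.prems(2) in auto)
  show ?case
  proof (cases X)
    case (Crossing a b c d)
    then show ?thesis
      using step[of "[(a, b), (c, d)]"] step[of "[(a, d), (b, c)]"]
      by (simp add: Field_def algebra_simps)
  next
    case (Arc a b)
    then show ?thesis using step[of "[(a, b)]"] by (simp add: Field_def)
  qed
qed

text \<open>The labels that \<open>f\<close> moves occur neither in \<open>ps\<close> nor in
  \<open>D\<close>, so the strands \<open>us\<close> can be pulled tight to \<open>vs\<close>
  whatever is attached to the remaining labels. With \<open>f = id\<close> this reorders or reverses
  strands.\<close>

lemma bracket_rec_contract:
  assumes fresh: "\<And>x. x \<in> Field (set ps) \<union> node_labels D \<Longrightarrow> f x = x"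
    and onto: "f ` Field (set us) = Field (set vs)"
    and us: "\<forall>(a, b)\<in>set us. (f a, f b) \<in> conn (set vs)"
    and vs: "\<forall>(a, b)\<in>set vs. (a, b) \<in> conn (set us)"
    and f: "\<forall>a\<in>Field (set us). (a, f a) \<in> conn (set us)"
  shows "bracket_rec (us @ ps) D = bracket_rec (vs @ ps) D"
proof -
  have "num_circles (qs @ us @ ps) = num_circles (qs @ vs @ ps)"
    if "Field (set qs) \<subseteq> node_labels D" for qs
  proof (rule num_circles_contract[where f = f])
    have U: "conn (set us) \<subseteq> conn (set (qs @ us @ ps))"
      and V: "conn (set vs) \<subseteq> conn (set (qs @ vs @ ps))"
      by (auto intro!: conn_mono)
    have id: "f x = x" if "x \<in> Field (set qs) \<union> Field (set ps)" for x
      using fresh that \<open>Field (set qs) \<subseteq> _\<close> by blast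
    have F: "Field (set (qs @ ws @ ps)) = (Field (set qs) \<union> Field (set ps)) \<union> Field (set ws)" for ws
      by (auto simp: Field_def)
    show "f ` Field (set (qs @ us @ ps)) = Field (set (qs @ vs @ ps))"
      unfolding F image_Un onto using id by force
    show "(f a, f b) \<in> conn (set (qs @ vs @ ps))" if "(a, b) \<in> set (qs @ us @ ps)" for a b
    proof (cases "(a, b) \<in> set us")
      case True
      then show ?thesis using us V by blast
    next
      case False
      then have "a \<in> Field (set qs) \<union> Field (set ps)" "b \<in> Field (set qs) \<union> Field (set ps)"
        using that by (auto simp: Field_def)
      then have "f a = a" "f b = b" using id by blast+
      then show ?thesis using False that by (auto intro: conn_pair)
    qed
    show "(a, b) \<in> conn (set (qs @ us @ ps))" if "(a, b) \<in> set (qs @ vs @ ps)" for a b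
    proof (cases "(a, b) \<in> set vs")
      case True
      then show ?thesis using vs U by blast
    next
      case False
      then show ?thesis using that by (auto intro: conn_pair)
    qed
    show "(a, f a) \<in> conn (set (qs @ us @ ps))" if "a \<in> Field (set (qs @ us @ ps))" for a
    proof (cases "a \<in> Field (set us)")
      case True
      then show ?thesis using f U by blast
    next
      case False
      then have "f a = a" using that id unfolding F by blast
      then show ?thesis by simp
    qed
  qed
  then have "bracket_rec (us @ ps) D = loop_d ^ 0 * bracket_rec (vs @ ps) D"
    by (intro bracket_rec_loops) auto
  then show ?thesis by simp
qed

lemma bracket_rec_commute: "bracket_rec (u # v # ps) D = bracket_rec (v # u # ps) D"
  using bracket_rec_contract[where f = id and us = "[u, v]" and vs = "[v, u]" and ps = ps and D = D]
  by (cases u; cases v) (auto simp: Field_def intro: conn_pair)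

lemma bracket_rec_flip: "bracket_rec ((x, y) # ps) D = bracket_rec ((y, x) # ps) D"
  using bracket_rec_contract[where f = id and us = "[(x, y)]" and vs = "[(y, x)]" and ps = ps]
  by (auto simp: Field_def intro: conn_pair conn_sym)

lemma bracket_rec_flip2: "bracket_rec (u # (x, y) # ps) D = bracket_rec (u # (y, x) # ps) D"
  by (metis bracket_rec_commute bracket_rec_flip)

lemma bracket_rec_loop:
  assumes "x \<notin> Field (set ps) \<union> node_labels D" "y \<notin> Field (set ps) \<union> node_labels D" "ps \<noteq> []"
  shows "bracket_rec ((x, y) # ps) D = loop_d * bracket_rec ps D"
proof -
  have "num_circles (qs @ (x, y) # ps) = 1 + num_circles (qs @ ps)"
    if "Field (set qs) \<subseteq> node_labels D" for qs
  proof -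
    have "num_circles ((x, y) # qs @ ps) = num_circles (qs @ ps) + 1"
      by (rule num_circles_loop) (use that assms in \<open>auto simp: Field_def\<close>)
    then show ?thesis using num_circles_set_cong[of "(x, y) # qs @ ps" "qs @ (x, y) # ps"] by simp
  qed
  from bracket_rec_loops[OF this] show ?thesis using assms(3) by simp
qed

text \<open>A row of crossings: \<open>X j\<close> lies between level \<open>j\<close> and level
  \<open>Suc j\<close>, and every level carries two labels. \<alpha> weights the smoothing that
  continues both strands, \<beta> the one that turns them back. Chains and sheafs are both rows of
  this kind; they differ in whether A or its inverse plays the part of \<alpha>.\<close>

context
  fixes i n :: nat and X :: "nat \<Rightarrow> strand_label node" and \<alpha> \<beta> :: "int laurent"
    and D :: "strand_label diagram"
  assumes resolve: "\<And>ps D j. bracket_rec ps (X j # D) =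
      \<alpha> * bracket_rec ((Inner i j True, Inner i (Suc j) True)
            # (Inner i j False, Inner i (Suc j) False) # ps) D
      + \<beta> * bracket_rec ((Inner i j True, Inner i j False)
            # (Inner i (Suc j) True, Inner i (Suc j) False) # ps) D"
    and labels_X: "\<And>j. set_node (X j) \<subseteq> {Inner i j' b | j' b. j' = j \<or> j' = Suc j}"
    and fresh_D: "\<And>j b. Inner i j b \<notin> node_labels D"
begin

lemma fresh_rest:
  assumes "m < l" shows "Inner i m b \<notin> node_labels (map X [l..<n] @ D)"
  using assms fresh_D labels_X by fastforce

text \<open>Below a capped level, the continuing smoothing moves the cap one level on, and the
  turning one splits off a free circle and leaves a new cap. Each crossing thus acts as a curl with
  factor \<alpha> + \<beta> d. Level \<open>n\<close> is allowed in \<open>ps\<close> because the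
  arcs at the far end of the row are already collected there.\<close>

lemma bracket_rec_cap:
  assumes "j \<le> n" "\<And>m b. m < n \<Longrightarrow> Inner i m b \<notin> Field (set ps)"
  shows "bracket_rec ((Inner i j True, Inner i j False) # ps) (map X [j..<n] @ D)
    = (\<alpha> + \<beta> * loop_d) ^ (n - j) * bracket_rec ((Inner i n True, Inner i n False) # ps) D"
  using assms
proof (induction "n - j" arbitrary: j)
  case 0
  then show ?case by simp
next
  case (Suc r)
  let ?P = "Inner i j True" and ?Q = "Inner i j False"
  let ?P' = "Inner i (Suc j) True" and ?Q' = "Inner i (Suc j) False"
  let ?E = "map X [Suc j..<n] @ D"
  have j: "j < n" using Suc.hyps by simp
  have fresh: "Inner i j b \<notin> Field (set ps) \<union> node_labels ?E" for b
    using fresh_rest[of j "Suc j"] Suc.prems(2)[OF j] by blast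
  have along: "bracket_rec ((?P, ?P') # (?Q, ?Q') # (?P, ?Q) # ps) ?E = bracket_rec ((?P', ?Q') # ps) ?E"
  proof -
    have "(?P', ?Q') \<in> conn {(?P, ?P'), (?Q, ?Q'), (?P, ?Q)}"
      by (meson conn_pair conn_sym conn_trans insertCI)
    then have "bracket_rec ([(?P, ?P'), (?Q, ?Q'), (?P, ?Q)] @ ps) ?E
        = bracket_rec ([(?P', ?Q')] @ ps) ?E"
      by (intro bracket_rec_contract[where f = "\<lambda>x. if x = ?P then ?P' else if x = ?Q then ?Q' else x"])
        (use fresh[of True] fresh[of False] in \<open>auto simp: Field_def split: if_splits intro: conn_pair\<close>)
    then show ?thesis by simp
  qed
  have cap: "bracket_rec ((?P, ?Q) # (?P', ?Q') # (?P, ?Q) # ps) ?E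
      = loop_d * bracket_rec ((?P', ?Q') # ps) ?E"
  proof -
    have "bracket_rec ((?P, ?Q) # (?P', ?Q') # (?P, ?Q) # ps) ?E
        = bracket_rec ((?P, ?Q) # (?P', ?Q') # ps) ?E"
      using bracket_rec_contract[where us = "[(?P, ?Q), (?P', ?Q'), (?P, ?Q)]"
          and vs = "[(?P, ?Q), (?P', ?Q')]" and f = id and ps = ps and D = ?E]
      by (auto simp: Field_def intro: conn_pair)
    also have "\<dots> = loop_d * bracket_rec ((?P', ?Q') # ps) ?E"
      by (rule bracket_rec_loop) (use fresh in \<open>auto simp: Field_def\<close>)
    finally show ?thesis .
  qed
  have "[j..<n] = j # [Suc j..<n]" using j by (simp add: upt_conv_Cons)
  then have "bracket_rec ((?P, ?Q) # ps) (map X [j..<n] @ D)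
      = (\<alpha> + \<beta> * loop_d) * bracket_rec ((?P', ?Q') # ps) ?E"
    by (simp add: resolve along cap algebra_simps)
  also have "\<dots> = (\<alpha> + \<beta> * loop_d) * ((\<alpha> + \<beta> * loop_d) ^ (n - Suc j)
      * bracket_rec ((Inner i n True, Inner i n False) # ps) D)"
    by (subst Suc.hyps(1)) (use Suc in auto)
  also have "\<dots> = (\<alpha> + \<beta> * loop_d) ^ (n - j) * bracket_rec ((Inner i n True, Inner i n False) # ps) D"
    using j by (simp add: Suc_diff_Suc flip: power_Suc mult.assoc)
  finally show ?case .
qed

text \<open>The index \<open>r\<close> counts the crossings continued before the first one that
  turns back. That one joins \<open>a\<close> to \<open>c\<close> and leaves a cap before the
  remaining \<open>n - j - Suc r\<close> crossings. If none turns back, both strands reach level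
  \<open>n\<close>.\<close>

lemma bracket_rec_open:
  assumes "j \<le> n" "\<And>m b. m < n \<Longrightarrow> Inner i m b \<notin> insert a (insert c (Field (set ps)))"
  shows "bracket_rec ((a, Inner i j True) # (c, Inner i j False) # ps) (map X [j..<n] @ D)
    = \<alpha> ^ (n - j) * bracket_rec ((a, Inner i n True) # (c, Inner i n False) # ps) D
      + (\<Sum>r<n - j. \<alpha> ^ r * \<beta> * (\<alpha> + \<beta> * loop_d) ^ (n - j - Suc r))
        * bracket_rec ((a, c) # (Inner i n True, Inner i n False) # ps) D"
  using assms
proof (induction "n - j" arbitrary: j)
  case 0
  then show ?case by simp
next
  case (Suc r)
  let ?P = "Inner i j True" and ?Q = "Inner i j False"
  let ?P' = "Inner i (Suc j) True" and ?Q' = "Inner i (Suc j) False"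
  let ?E = "map X [Suc j..<n] @ D"
  let ?\<gamma> = "\<alpha> + \<beta> * loop_d"
  let ?op = "bracket_rec ((a, Inner i n True) # (c, Inner i n False) # ps) D"
  let ?ca = "bracket_rec ((a, c) # (Inner i n True, Inner i n False) # ps) D"
  have j: "j < n" using Suc.hyps by simp
  have fresh: "Inner i j b \<notin> Field (set ps) \<union> node_labels ?E" "Inner i j b \<noteq> a" "Inner i j b \<noteq> c" for b
    using fresh_rest[of j "Suc j"] Suc.prems(2)[OF j] by blast+
  have along: "bracket_rec ((?P, ?P') # (?Q, ?Q') # (a, ?P) # (c, ?Q) # ps) ?E
      = bracket_rec ((a, ?P') # (c, ?Q') # ps) ?E"
  proof -
    let ?R = "{(?P, ?P'), (?Q, ?Q'), (a, ?P), (c, ?Q)}"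
    have "(a, ?P') \<in> conn ?R" "(c, ?Q') \<in> conn ?R"
      by (meson conn_pair conn_sym conn_trans insertCI)+
    then have "bracket_rec ([(?P, ?P'), (?Q, ?Q'), (a, ?P), (c, ?Q)] @ ps) ?E
        = bracket_rec ([(a, ?P'), (c, ?Q')] @ ps) ?E"
      by (intro bracket_rec_contract[where f = "\<lambda>x. if x = ?P then ?P' else if x = ?Q then ?Q' else x"])
        (use fresh(1)[of True] fresh(1)[of False] fresh(2)[of True] fresh(2)[of False] fresh(3)[of True] fresh(3)[of False] in \<open>auto simp: Field_def split: if_splits intro: conn_pair\<close>)
    then show ?thesis by simp
  qed
  have cap: "bracket_rec ((?P, ?Q) # (?P', ?Q') # (a, ?P) # (c, ?Q) # ps) ?E
      = bracket_rec ((?P', ?Q') # (a, c) # ps) ?E"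
  proof -
    let ?R = "{(?P, ?Q), (?P', ?Q'), (a, ?P), (c, ?Q)}"
    have "(a, c) \<in> conn ?R" "(?P, a) \<in> conn ?R" "(?Q, c) \<in> conn ?R"
      by (meson conn_pair conn_sym conn_trans insertCI)+
    then have "bracket_rec ([(?P, ?Q), (?P', ?Q'), (a, ?P), (c, ?Q)] @ ps) ?E
        = bracket_rec ([(?P', ?Q'), (a, c)] @ ps) ?E"
      by (intro bracket_rec_contract[where f = "\<lambda>x. if x = ?P then a else if x = ?Q then c else x"])
        (use fresh(1)[of True] fresh(1)[of False] fresh(2)[of True] fresh(2)[of False] fresh(3)[of True] fresh(3)[of False] in \<open>auto simp: Field_def split: if_splits intro: conn_pair\<close>)
    then show ?thesis by simp
  qed
  have "[j..<n] = j # [Suc j..<n]" using j by (simp add: upt_conv_Cons)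
  then have "bracket_rec ((a, ?P) # (c, ?Q) # ps) (map X [j..<n] @ D)
      = \<alpha> * bracket_rec ((a, ?P') # (c, ?Q') # ps) ?E
        + \<beta> * bracket_rec ((?P', ?Q') # (a, c) # ps) ?E"
    by (simp add: resolve along cap)
  also have "bracket_rec ((a, ?P') # (c, ?Q') # ps) ?E = \<alpha> ^ (n - Suc j) * ?op
      + (\<Sum>r<n - Suc j. \<alpha> ^ r * \<beta> * ?\<gamma> ^ (n - Suc j - Suc r)) * ?ca"
    by (subst Suc.hyps(1)) (use Suc in auto)
  also have "bracket_rec ((?P', ?Q') # (a, c) # ps) ?E = ?\<gamma> ^ (n - Suc j) * ?ca"
  proof -
    have "Inner i m b \<notin> Field (set ((a, c) # ps))" if "m < n" for m b
      using Suc.prems(2)[OF that] by (auto simp: Field_def)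
    then have "bracket_rec ((?P', ?Q') # (a, c) # ps) ?E = ?\<gamma> ^ (n - Suc j)
        * bracket_rec ((Inner i n True, Inner i n False) # (a, c) # ps) D"
      using bracket_rec_cap[of "Suc j" "(a, c) # ps"] j by auto
    then show ?thesis by (simp add: bracket_rec_commute[of "(a, c)"])
  qed
  also have "\<alpha> * (\<alpha> ^ (n - Suc j) * ?op
      + (\<Sum>r<n - Suc j. \<alpha> ^ r * \<beta> * ?\<gamma> ^ (n - Suc j - Suc r)) * ?ca) + \<beta> * (?\<gamma> ^ (n - Suc j) * ?ca)
    = \<alpha> ^ (n - j) * ?op + (\<Sum>r<n - j. \<alpha> ^ r * \<beta> * ?\<gamma> ^ (n - j - Suc r)) * ?ca"
  proof -
    \<comment> \<open>Splitting off the term \<open>r = 0\<close>, where the crossing at level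
      \<open>j\<close> itself turns back, matches the recursion.\<close>
    have nj: "n - j = Suc (n - Suc j)" using j by simp
    show ?thesis
      unfolding nj sum.lessThan_Suc_shift by (simp add: algebra_simps sum_distrib_left)
  qed
  finally show ?case .
qed

lemma bracket_rec_tangle:
  assumes "\<And>m b. Inner i m b \<notin> insert a (insert c (insert u (insert v (Field (set ps)))))"
  shows "bracket_rec ps ([Arc a (Inner i 0 True), Arc c (Inner i 0 False),
      Arc u (Inner i n False), Arc v (Inner i n True)] @ map X [0..<n] @ D)
    = \<alpha> ^ n * bracket_rec ([(a, v), (c, u)] @ ps) D
      + (\<Sum>r<n. \<alpha> ^ r * \<beta> * (\<alpha> + \<beta> * loop_d) ^ (n - Suc r)) * bracket_rec ([(a, c), (u, v)] @ ps) D"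
proof -
  let ?P = "Inner i n True" and ?Q = "Inner i n False"
  let ?ps = "(v, ?P) # (u, ?Q) # ps"
  have "bracket_rec ps ([Arc a (Inner i 0 True), Arc c (Inner i 0 False),
      Arc u (Inner i n False), Arc v (Inner i n True)] @ map X [0..<n] @ D)
    = bracket_rec ((a, Inner i 0 True) # (c, Inner i 0 False) # ?ps) (map X [0..<n] @ D)"
    using bracket_rec_contract[where f = id and ps = ps and D = "map X [0..<n] @ D"
        and us = "[(v, ?P), (u, ?Q), (c, Inner i 0 False), (a, Inner i 0 True)]"
        and vs = "[(a, Inner i 0 True), (c, Inner i 0 False), (v, ?P), (u, ?Q)]"]
    by (auto simp: Field_def intro: conn_pair)
  also have "\<dots> = \<alpha> ^ n * bracket_rec ((a, ?P) # (c, ?Q) # ?ps) D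
      + (\<Sum>r<n. \<alpha> ^ r * \<beta> * (\<alpha> + \<beta> * loop_d) ^ (n - Suc r)) * bracket_rec ((a, c) # (?P, ?Q) # ?ps) D"
    using bracket_rec_open[of 0 a c ?ps] assms by (auto simp: Field_def)
  also have "bracket_rec ((a, ?P) # (c, ?Q) # ?ps) D = bracket_rec ([(a, v), (c, u)] @ ps) D"
  proof -
    let ?R = "{(a, ?P), (c, ?Q), (v, ?P), (u, ?Q)}"
    have "(a, v) \<in> conn ?R" "(c, u) \<in> conn ?R" "(?P, v) \<in> conn ?R" "(?Q, u) \<in> conn ?R"
      by (meson conn_pair conn_sym conn_trans insertCI)+
    then have "bracket_rec ([(a, ?P), (c, ?Q), (v, ?P), (u, ?Q)] @ ps) D
        = bracket_rec ([(a, v), (c, u)] @ ps) D"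
      by (intro bracket_rec_contract[where f = "\<lambda>x. if x = ?P then v else if x = ?Q then u else x"])
        (use assms[of n True] assms[of n False] fresh_D[of n True] fresh_D[of n False] in \<open>auto simp: Field_def split: if_splits intro: conn_pair\<close>)
    then show ?thesis by simp
  qed
  also have "bracket_rec ((a, c) # (?P, ?Q) # ?ps) D = bracket_rec ([(a, c), (u, v)] @ ps) D"
  proof -
    let ?R = "{(a, c), (?P, ?Q), (v, ?P), (u, ?Q)}"
    have "(u, v) \<in> conn ?R" "(?P, v) \<in> conn ?R" "(?Q, u) \<in> conn ?R"
      by (meson conn_pair conn_sym conn_trans insertCI)+
    moreover have "(v, u) \<in> conn {(a, c), (u, v)}"
      by (meson conn_pair conn_sym insertCI)
    ultimately have "bracket_rec ([(a, c), (?P, ?Q), (v, ?P), (u, ?Q)] @ ps) D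
        = bracket_rec ([(a, c), (u, v)] @ ps) D"
      by (intro bracket_rec_contract[where f = "\<lambda>x. if x = ?P then v else if x = ?Q then u else x"])
        (use assms[of n True] assms[of n False] fresh_D[of n True] fresh_D[of n False] in \<open>auto simp: Field_def split: if_splits intro: conn_pair\<close>)
    then show ?thesis by simp
  qed
  finally show ?thesis .
qed

end

section \<open>The tangle of an edge and the state sum\<close>

definition edge_tangle :: "colored_graph \<Rightarrow> (nat \<Rightarrow> int) \<Rightarrow> nat \<Rightarrow> strand_label diagram" where
  "edge_tangle G t i =
     (case color G i of Col_c \<Rightarrow> chain_tangle i (t i) | Col_s \<Rightarrow> sheaf_tangle i (t i))"

text \<open>The flag \<open>m\<close> tells whether the two shaded regions at the edge are merged, and \<open>twist_var u\<close> is the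
  coefficient of the smoothing of one crossing that keeps the twist going.\<close>

definition edge_state :: "bool \<Rightarrow> nat \<Rightarrow> (strand_label \<times> strand_label) list" where
  "edge_state m i = [(Lft (i, False), Rgt (i, m)), (Lft (i, True), Rgt (i, \<not> m))]"

definition twist_var :: "bool \<Rightarrow> int laurent" where
  "twist_var u = (if u then var_A else var_A_inv)"

definition turned_coeff :: "bool \<Rightarrow> nat \<Rightarrow> int laurent" where
  "turned_coeff u n = (\<Sum>r<n. twist_var u ^ r * twist_var (\<not> u)
      * (twist_var u + twist_var (\<not> u) * loop_d) ^ (n - Suc r))"

text \<open>Continuing along the row merges the shaded regions for a chain and separates them for a
  sheaf, and a positive crossing merges with weight A. Hence \<open>u\<close> tells whether
  continuing has weight A. For \<open>t i = 0\<close> the two coefficients are 1 and 0, which leaves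
  exactly the prescribed filling.\<close>

definition edge_coeff :: "colored_graph \<Rightarrow> (nat \<Rightarrow> int) \<Rightarrow> bool \<Rightarrow> nat \<Rightarrow> int laurent" where
  "edge_coeff G t m i =
     (let u = ((t i > 0) = (color G i = Col_c)); n = nat \<bar>t i\<bar>
      in if m = (color G i = Col_c) then twist_var u ^ n else turned_coeff u n)"

lemma node_labels_edge_tangle:
  assumes "Inner i j b \<in> node_labels (edge_tangle G t i')" shows "i = i'"
  using assms
  by (auto simp: edge_tangle_def chain_tangle_def sheaf_tangle_def Let_def signed_crossing_def
      split: color.splits if_splits)

lemma bracket_rec_chain_crossing:
  "bracket_rec ps (signed_crossing u p q q' p' # D) =
    twist_var u * bracket_rec ((p, p') # (q, q') # ps) D
    + twist_var (\<not> u) * bracket_rec ((p, q) # (p', q') # ps) D"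
  by (simp add: signed_crossing_def twist_var_def bracket_rec_flip[of p' p]
      bracket_rec_commute[of "(p', q')" "(p, q)"] bracket_rec_flip2[of "(p, q)" q' p'] add.commute)

lemma bracket_rec_sheaf_crossing:
  "bracket_rec ps (signed_crossing u p' p q q' # D) =
    twist_var (\<not> u) * bracket_rec ((p, p') # (q, q') # ps) D
    + twist_var u * bracket_rec ((p, q) # (p', q') # ps) D"
proof -
  have "bracket_rec ((q', q) # (p', p) # ps) D = bracket_rec ((p, p') # (q, q') # ps) D"
    "bracket_rec ((q', p') # (p, q) # ps) D = bracket_rec ((p, q) # (p', q') # ps) D"
    by (metis bracket_rec_commute bracket_rec_flip)+
  then show ?thesis
    by (simp add: signed_crossing_def twist_var_def bracket_rec_flip[of p' p]
        bracket_rec_commute[of "(p', q')" "(p, q)"] add.commute)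
qed

lemma bracket_rec_edge_tangle:
  assumes ps: "\<And>m b. Inner i m b \<notin> Field (set ps)" and D: "\<And>m b. Inner i m b \<notin> node_labels D"
  shows "bracket_rec ps (edge_tangle G t i @ D)
    = edge_coeff G t True i * bracket_rec (edge_state True i @ ps) D
      + edge_coeff G t False i * bracket_rec (edge_state False i @ ps) D"
proof -
  let ?n = "nat \<bar>t i\<bar>" and ?u = "t i > 0"
  let ?a = "Lft (i, False)" and ?b = "Rgt (i, False)" and ?c = "Lft (i, True)" and ?d = "Rgt (i, True)"
  have flip: "bracket_rec ((x, y) # (z, w) # ps) D = bracket_rec ((x, y) # (w, z) # ps) D"
    "bracket_rec ((x, y) # (z, w) # ps) D = bracket_rec ((y, x) # (z, w) # ps) D"
    "bracket_rec ((x, y) # (z, w) # ps) D = bracket_rec ((w, z) # (y, x) # ps) D" for x y z w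
    by (metis bracket_rec_commute bracket_rec_flip)+
  show ?thesis
  proof (cases "color G i")
    case Col_c
    define X where "X = (\<lambda>j. signed_crossing ?u (Inner i j True) (Inner i j False)
        (Inner i (Suc j) False) (Inner i (Suc j) True))"
    have labels: "set_node (X j) \<subseteq> {Inner i j' b | j' b. j' = j \<or> j' = Suc j}" for j
      by (auto simp: X_def signed_crossing_def)
    have "bracket_rec ps ([Arc ?a (Inner i 0 True), Arc ?b (Inner i 0 False),
        Arc ?c (Inner i ?n False), Arc ?d (Inner i ?n True)] @ map X [0..<?n] @ D)
      = twist_var ?u ^ ?n * bracket_rec ([(?a, ?d), (?b, ?c)] @ ps) D
        + turned_coeff ?u ?n * bracket_rec ([(?a, ?b), (?c, ?d)] @ ps) D"
      unfolding turned_coeff_def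
      by (rule bracket_rec_tangle[OF _ labels D]) (use ps in \<open>auto simp: X_def bracket_rec_chain_crossing\<close>)
    moreover have "edge_tangle G t i = [Arc ?a (Inner i 0 True), Arc ?b (Inner i 0 False),
        Arc ?c (Inner i ?n False), Arc ?d (Inner i ?n True)] @ map X [0..<?n]"
      by (simp add: edge_tangle_def chain_tangle_def Col_c X_def Let_def)
    ultimately show ?thesis
      using flip(1)[of ?a ?d ?b ?c] by (simp add: Col_c edge_coeff_def edge_state_def)
  next
    case Col_s
    define X where "X = (\<lambda>j. signed_crossing ?u (Inner i (Suc j) True) (Inner i j True)
        (Inner i j False) (Inner i (Suc j) False))"
    have labels: "set_node (X j) \<subseteq> {Inner i j' b | j' b. j' = j \<or> j' = Suc j}" for j
      by (auto simp: X_def signed_crossing_def)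
    have "bracket_rec ps ([Arc ?b (Inner i 0 True), Arc ?c (Inner i 0 False),
        Arc ?d (Inner i ?n False), Arc ?a (Inner i ?n True)] @ map X [0..<?n] @ D)
      = twist_var (\<not> ?u) ^ ?n * bracket_rec ([(?b, ?a), (?c, ?d)] @ ps) D
        + turned_coeff (\<not> ?u) ?n * bracket_rec ([(?b, ?c), (?d, ?a)] @ ps) D"
      unfolding turned_coeff_def
      by (rule bracket_rec_tangle[OF _ labels D]) (use ps in \<open>auto simp: X_def bracket_rec_sheaf_crossing\<close>)
    moreover have "edge_tangle G t i = [Arc ?b (Inner i 0 True), Arc ?c (Inner i 0 False),
        Arc ?a (Inner i ?n True), Arc ?d (Inner i ?n False)] @ map X [0..<?n]"
      by (simp add: edge_tangle_def sheaf_tangle_def Col_s X_def Let_def)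
    \<comment> \<open>\<open>sheaf_tangle\<close> lists the two arcs at the far end in the opposite
      order to \<open>bracket_rec_tangle\<close>.\<close>
    moreover have "bracket_rec ((?d, Inner i ?n False) # (?a, Inner i ?n True) # rs) E
        = bracket_rec ((?a, Inner i ?n True) # (?d, Inner i ?n False) # rs) E" for rs E
      by (rule bracket_rec_commute)
    ultimately show ?thesis
      using flip(2)[of ?b ?a ?c ?d] flip(3)[of ?b ?c ?d ?a]
      by (simp add: Col_s edge_coeff_def edge_state_def)
  qed
qed

lemma bracket_rec_Arcs:
  "bracket_rec ps (map (\<lambda>z. Arc (f z) (g z)) zs)
    = loop_d ^ (num_circles (rev (map (\<lambda>z. (f z, g z)) zs) @ ps) - 1)"
  by (induction zs arbitrary: ps) auto

definition smoothing_strands :: "colored_graph \<Rightarrow> nat set \<Rightarrow> (strand_label \<times> strand_label) list" where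
  "smoothing_strands G F = concat (map (\<lambda>i. edge_state (i \<in> F) i) [0..<num_edges G])
     @ map (\<lambda>z. (Lft z, Rgt (turn G z))) (List.product [0..<num_edges G] [False, True])"

definition circles :: "colored_graph \<Rightarrow> nat set \<Rightarrow> nat" where
  "circles G F = num_circles (smoothing_strands G F)"

lemma bracket_rec_edges:
  assumes "distinct js" "\<And>i m b. Inner i m b \<notin> Field (set ps)"
  shows "bracket_rec ps (concat (map (edge_tangle G t) js) @ map (\<lambda>z. Arc (Lft z) (Rgt (f z))) zs)
    = (\<Sum>F\<in>Pow (set js). (\<Prod>i\<in>set js. edge_coeff G t (i \<in> F) i)
        * loop_d ^ (num_circles (concat (map (\<lambda>i. edge_state (i \<in> F) i) js) @ ps
            @ map (\<lambda>z. (Lft z, Rgt (f z))) zs) - 1))"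
  using assms
proof (induction js arbitrary: ps)
  case Nil
  have "num_circles (rev (map (\<lambda>z. (Lft z, Rgt (f z))) zs) @ ps)
      = num_circles (ps @ map (\<lambda>z. (Lft z, Rgt (f z))) zs)"
    by (rule num_circles_set_cong) auto
  then show ?case by (simp add: bracket_rec_Arcs)
next
  case (Cons j js)
  let ?arcs = "map (\<lambda>z. (Lft z, Rgt (f z))) zs"
  let ?term = "\<lambda>ks ps F. (\<Prod>i\<in>set ks. edge_coeff G t (i \<in> F) i)
        * loop_d ^ (num_circles (concat (map (\<lambda>i. edge_state (i \<in> F) i) ks) @ ps @ ?arcs) - 1)"
  have j: "j \<notin> set js" using Cons.prems(1) by simp
  have fresh: "Inner j m b \<notin> node_labels (concat (map (edge_tangle G t) js)
      @ map (\<lambda>z. Arc (Lft z) (Rgt (f z))) zs)" for m b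
    using node_labels_edge_tangle[of j m b] j by fastforce
  have IH: "bracket_rec (edge_state m j @ ps) (concat (map (edge_tangle G t) js)
        @ map (\<lambda>z. Arc (Lft z) (Rgt (f z))) zs)
      = (\<Sum>F\<in>Pow (set js). ?term js (edge_state m j @ ps) F)" for m
    by (rule Cons.IH) (use Cons.prems in \<open>auto simp: edge_state_def Field_def\<close>)
  have reorder: "num_circles (concat (map (\<lambda>i. edge_state (i \<in> F) i) js) @ (edge_state m j @ ps) @ ?arcs)
      = num_circles (edge_state m j @ concat (map (\<lambda>i. edge_state (i \<in> F) i) js) @ ps @ ?arcs)" for m F
    by (rule num_circles_set_cong) auto
  have out: "?term (j # js) ps F = edge_coeff G t False j * ?term js (edge_state False j @ ps) F"
    if "F \<in> Pow (set js)" for F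
  proof -
    have "j \<notin> F" using that j by auto
    then show ?thesis using j by (simp only: reorder) (simp add: mult.assoc)
  qed
  have into: "?term (j # js) ps (insert j F) = edge_coeff G t True j * ?term js (edge_state True j @ ps) F"
    if "F \<in> Pow (set js)" for F
  proof -
    have mem: "i \<in> insert j F \<longleftrightarrow> i \<in> F" if "i \<in> set js" for i
      using j that by blast
    have "(\<Prod>i\<in>set js. edge_coeff G t (i \<in> insert j F) i) = (\<Prod>i\<in>set js. edge_coeff G t (i \<in> F) i)"
      using mem by (intro prod.cong) (simp_all only:)
    moreover have "map (\<lambda>i. edge_state (i \<in> insert j F) i) js = map (\<lambda>i. edge_state (i \<in> F) i) js"
      using mem by (intro map_cong) (simp_all only:)
    ultimately show ?thesis
      using j by (simp only: reorder) (simp add: mult.assoc insertI1 del: insert_iff map_eq_conv)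
  qed
  have inj: "inj_on (insert j) (Pow (set js))"
    using j by (auto simp: inj_on_def insert_ident)
  have "(\<Sum>F\<in>Pow (set (j # js)). ?term (j # js) ps F)
      = (\<Sum>F\<in>Pow (set js). ?term (j # js) ps F) + (\<Sum>F\<in>insert j ` Pow (set js). ?term (j # js) ps F)"
    unfolding list.set Pow_insert by (rule sum.union_disjoint) (use j in auto)
  also have "\<dots> = edge_coeff G t False j * (\<Sum>F\<in>Pow (set js). ?term js (edge_state False j @ ps) F)
      + edge_coeff G t True j * (\<Sum>F\<in>Pow (set js). ?term js (edge_state True j @ ps) F)"
    unfolding sum.reindex[OF inj] o_def sum_distrib_left
    by (intro arg_cong2[where f = "(+)"] sum.cong refl out into)
  also have "\<dots> = bracket_rec ps (edge_tangle G t j @ concat (map (edge_tangle G t) js)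
        @ map (\<lambda>z. Arc (Lft z) (Rgt (f z))) zs)"
    unfolding bracket_rec_edge_tangle[OF Cons.prems(2) fresh] IH by (simp only: add.commute)
  finally show ?case by simp
qed

lemma kauffman_bracket_twisted_diagram:
  "kauffman_bracket (twisted_diagram G t) = (\<Sum>F\<in>Pow {..<num_edges G}.
      (\<Prod>i<num_edges G. edge_coeff G t (i \<in> F) i) * loop_d ^ (circles G F - 1))"
  using bracket_rec_edges[of "[0..<num_edges G]" "[]" G t "turn G"
      "List.product [0..<num_edges G] [False, True]"]
  by (simp add: kauffman_bracket_def twisted_diagram_def edge_tangle_def[abs_def] circles_def
      smoothing_strands_def lessThan_atLeast0)

section \<open>States, trees and circles\<close>

text \<open>In the state \<open>F\<close> the label \<open>Lft z\<close> has two strands, to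
  \<open>Rgt (across F z)\<close> inside the edge and to \<open>Rgt (turn G z)\<close> around the
  corner. Both partners are given by bijections of the darts, so circles alternate between left and
  right labels; the counting arguments below rest on this.\<close>

definition across :: "nat set \<Rightarrow> nat \<times> bool \<Rightarrow> nat \<times> bool" where
  "across F z = (fst z, snd z \<noteq> (fst z \<in> F))"

lemma across_across [simp]: "across F (across F z) = z"
  by (cases z) (auto simp: across_def)

lemma fst_across [simp]: "fst (across F z) = fst z"
  by (simp add: across_def)

abbreviation edge_darts :: "colored_graph \<Rightarrow> (nat \<times> bool) set" where
  "edge_darts G \<equiv> {..<num_edges G} \<times> UNIV"

lemma across_in_gdarts [simp]: "across F z \<in> edge_darts G \<longleftrightarrow> z \<in> edge_darts G"
  by (cases z) (simp add: across_def)

lemma set_smoothing_strands: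
  "set (smoothing_strands G F)
    = (\<lambda>z. (Lft z, Rgt (across F z))) ` edge_darts G \<union> (\<lambda>z. (Lft z, Rgt (turn G z))) ` edge_darts G"
proof -
  have st: "set (edge_state (i \<in> F) i) = (\<lambda>z. (Lft z, Rgt (across F z))) ` ({i} \<times> UNIV)" for i
    by (simp add: edge_state_def across_def UNIV_bool insert_Times_insert)
  have "(\<Union>i<num_edges G. set (edge_state (i \<in> F) i)) = (\<lambda>z. (Lft z, Rgt (across F z))) ` edge_darts G"
    unfolding st by blast
  moreover have "set (List.product [0..<num_edges G] [False, True]) = edge_darts G"
    by (auto simp: UNIV_bool)
  ultimately show ?thesis
    unfolding smoothing_strands_def set_append set_concat set_map image_image
    by (simp add: lessThan_atLeast0)
qed

text \<open>Sending each class to the coarser class containing it is onto, and it identifies the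
  classes of \<open>x\<close> and \<open>y\<close>.\<close>

lemma num_circles_less:
  assumes "Field (set ps) = Field (set qs)" "conn (set ps) \<subseteq> conn (set qs)"
    and "x \<in> Field (set ps)" "y \<in> Field (set ps)" "(x, y) \<in> conn (set qs)" "(x, y) \<notin> conn (set ps)"
  shows "num_circles qs < num_circles ps"
proof -
  let ?P = "conn (set ps)" and ?Q = "conn (set qs)"
  let ?cl = "(\<lambda>a. ?P `` {a}) ` Field (set ps)"
  have cl: "?Q `` (?P `` {a}) = ?Q `` {a}" for a
  proof (intro set_eqI iffI)
    fix z assume "z \<in> ?Q `` (?P `` {a})"
    then obtain y where "(a, y) \<in> ?P" "(y, z) \<in> ?Q" by auto
    then show "z \<in> ?Q `` {a}" using assms(2) conn_trans[of a y _ z] by blast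
  next
    fix z assume "z \<in> ?Q `` {a}"
    moreover have "a \<in> ?P `` {a}" by simp
    ultimately show "z \<in> ?Q `` (?P `` {a})" by blast
  qed
  have "(\<lambda>a. ?Q `` {a}) ` Field (set qs) = (\<lambda>X. ?Q `` X) ` ?cl"
    unfolding image_image cl assms(1) ..
  moreover have "card ((\<lambda>X. ?Q `` X) ` ?cl) \<noteq> card ?cl"
  proof
    assume "card ((\<lambda>X. ?Q `` X) ` ?cl) = card ?cl"
    then have inj: "inj_on (\<lambda>X. ?Q `` X) ?cl" by (intro eq_card_imp_inj_on) auto
    have "?Q `` (?P `` {x}) = ?Q `` (?P `` {y})"
      unfolding cl conn_class_eq_iff by (rule assms(5))
    with inj have "?P `` {x} = ?P `` {y}" using assms(3,4) by (meson imageI inj_onD)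
    with assms(6) show False by (simp add: conn_class_eq_iff)
  qed
  moreover have "card ((\<lambda>X. ?Q `` X) ` ?cl) \<le> card ?cl" by (intro card_image_le) auto
  ultimately show ?thesis unfolding num_circles_conn by simp
qed

text \<open>The maps of a graph are bijective on its darts only. Extending by the identity gives a
  permutation of the whole type with the same orbits inside \<open>A\<close>.\<close>

lemma orbit_step_on:
  assumes "bij_betw f A A" "finite A" "x \<in> A"
  shows "orbit f (f x) = orbit f x"
proof -
  let ?g = "\<lambda>y. if y \<in> A then f y else y"
  have "?g permutes A"
    by (rule bij_imp_permutes) (use assms(1) in \<open>auto cong: bij_betw_cong\<close>)
  then have perm: "permutation ?g" using assms(2) by (auto simp: permutation_permutes)
  have f: "f \<in> A \<rightarrow> A" using assms(1) by (auto simp: bij_betw_def)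
  have orb: "orbit f y = orbit ?g y" if "y \<in> A" for y
    by (rule orbit_cong0[OF that f]) simp
  have "orbit ?g (f x) = orbit ?g x"
    using permutation_orbit_step[OF perm, of x] assms(3) by simp
  moreover have "f x \<in> A" using f assms(3) by (rule funcset_mem)
  ultimately show ?thesis using orb[of x] orb[of "f x"] assms(3) by metis
qed

section \<open>Lowering the number of circles by changing one edge\<close>

locale plane_colored_graph =
  fixes G :: colored_graph
  assumes plane: "plane_graph G" and num_edges_pos: "num_edges G \<ge> 1"
begin

lemma turn_bij: "bij_betw (turn G) (edge_darts G) (edge_darts G)"
  using plane by (simp add: plane_graph_def graph_map_def)

lemma turn_in_gdarts: "z \<in> edge_darts G \<Longrightarrow> turn G z \<in> edge_darts G"
  using turn_bij by (meson bij_betwE)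

lemma gdarts_turnE:
  assumes "w \<in> edge_darts G" obtains z where "z \<in> edge_darts G" "w = turn G z"
  using assms turn_bij by (metis bij_betw_def imageE)

lemma Field_smoothing_strands:
  "Field (set (smoothing_strands G F)) = Lft ` edge_darts G \<union> Rgt ` edge_darts G"
proof -
  have img: "(\<lambda>z. f (g z)) ` A = f ` A" if "g ` A = A" for f :: "nat \<times> bool \<Rightarrow> strand_label" and g A
    using that by (metis image_image)
  have "across F ` edge_darts G = edge_darts G"
  proof (intro subset_antisym image_subsetI subsetI)
    show "z \<in> across F ` edge_darts G" if "z \<in> edge_darts G" for z
      by (rule image_eqI[where x = "across F z"]) (simp_all only: across_across across_in_gdarts that)
  qed (simp only: across_in_gdarts)
  moreover have "turn G ` edge_darts G = edge_darts G"
    using turn_bij by (rule bij_betw_imp_surj_on)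
  ultimately show ?thesis
    unfolding set_smoothing_strands Field_def Domain_fst Range_snd image_Un image_image fst_conv snd_conv
    by (simp only: img Un_absorb)
qed

lemma circles_pos: "circles G F \<ge> 1"
  unfolding circles_def
proof (rule num_circles_pos)
  have "Lft (0, False) \<in> Field (set (smoothing_strands G F))"
    using num_edges_pos by (auto simp: Field_smoothing_strands)
  then show "smoothing_strands G F \<noteq> []" by auto
qed

lemma conn_across: "z \<in> edge_darts G \<Longrightarrow> (Lft z, Rgt (across F z)) \<in> conn (set (smoothing_strands G F))"
  by (rule conn_pair) (auto simp: set_smoothing_strands)

lemma conn_turn: "z \<in> edge_darts G \<Longrightarrow> (Lft z, Rgt (turn G z)) \<in> conn (set (smoothing_strands G F))"
  by (rule conn_pair) (auto simp: set_smoothing_strands)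

text \<open>If every edge met only one circle, that circle would be passed on across edges and
  around vertices, hence to all labels since \<open>G\<close> is connected.\<close>

lemma ex_edge_two_circles:
  assumes "circles G F \<noteq> 1"
  obtains i where "i < num_edges G"
    "(Lft (i, False), Lft (i, True)) \<notin> conn (set (smoothing_strands G F))"
proof (rule ccontr)
  assume "\<not> thesis"
  let ?T = "conn (set (smoothing_strands G F))"
  have all: "(Lft (i, False), Lft (i, True)) \<in> ?T" if "i < num_edges G" for i
    using that \<open>\<not> thesis\<close> \<open>\<And>i. i < _ \<Longrightarrow> _ \<notin> _ \<Longrightarrow> thesis\<close> by blast
  have edge: "(Lft (i, b), Lft (i, c)) \<in> ?T" if "i < num_edges G" for i b c
    using all[OF that] conn_sym[OF all[OF that]] by (cases b; cases c) auto
  have rgt: "(Lft z, Rgt z) \<in> ?T" if "z \<in> edge_darts G" for z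
  proof -
    have "(Lft z, Lft (across F z)) \<in> ?T" using that edge by (cases z) (auto simp: across_def)
    moreover have "(Lft (across F z), Rgt z) \<in> ?T" using conn_across[of "across F z" F] that by simp
    ultimately show ?thesis by (rule conn_trans)
  qed
  have turn: "(Lft z, Lft (turn G z)) \<in> ?T" if "z \<in> edge_darts G" for z
    using conn_turn[OF that] conn_sym[OF rgt[OF turn_in_gdarts[OF that]]] by (rule conn_trans)
  let ?z = "(0, False)"
  have z: "?z \<in> edge_darts G" using num_edges_pos by auto
  have lft: "(Lft ?z, Lft w) \<in> ?T" if "w \<in> edge_darts G" for w
  proof -
    have "w \<in> component (graph_map G) ?z"
      using that z plane by (simp add: plane_graph_def connected_map_def graph_map_def)
    then have "(?z, w) \<in> ({(x, case x of (i, b) \<Rightarrow> (i, \<not> b)) | x. x \<in> edge_darts G}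
        \<union> {(x, turn G x) | x. x \<in> edge_darts G})\<^sup>*"
      by (simp add: component_def graph_map_def)
    then show ?thesis
    proof induction
      case (step x y)
      have "(Lft x, Lft y) \<in> ?T" using step(2) edge turn by auto
      with step.IH show ?case by (rule conn_trans)
    qed simp
  qed
  have "?T `` {x} = ?T `` {Lft ?z}" if "x \<in> Field (set (smoothing_strands G F))" for x
    unfolding conn_class_eq_iff
  proof -
    from that obtain w where w: "w \<in> edge_darts G" "x = Lft w \<or> x = Rgt w"
      unfolding Field_smoothing_strands by blast
    then have "(Lft ?z, x) \<in> ?T" using lft[OF w(1)] rgt[OF w(1)] conn_trans by metis
    then show "(x, Lft ?z) \<in> ?T" by (rule conn_sym)
  qed
  then have "(\<lambda>x. ?T `` {x}) ` Field (set (smoothing_strands G F)) \<subseteq> {?T `` {Lft ?z}}"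
    by blast
  then have "circles G F \<le> 1"
    unfolding circles_def num_circles_conn using card_mono[of "{?T `` {Lft ?z}}"] by fastforce
  with circles_pos[of F] assms show False by simp
qed

text \<open>A circle cut at one strand stays connected by parity: the component of the cut end \<open>Lft (i, b)\<close>
  has as many \<open>Lft\<close> as \<open>Rgt\<close> labels, matched by \<open>turn G\<close>, whereas the uncut strands would match
  all its labels except \<open>Lft (i, b)\<close>.\<close>

lemma conn_cut:
  fixes i b and F
  defines "T \<equiv> set (smoothing_strands G F)"
  defines "Tc \<equiv> (\<lambda>z. (Lft z, Rgt (across F z))) ` (edge_darts G - {(i, False), (i, True)})
      \<union> (\<lambda>z. (Lft z, Rgt (turn G z))) ` edge_darts G"
  assumes "i < num_edges G" "(Lft (i, b), Lft (i, \<not> b)) \<notin> conn T"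
  shows "(Lft (i, b), Rgt (across F (i, b))) \<in> conn Tc"
proof (rule ccontr)
  assume notin: "(Lft (i, b), Rgt (across F (i, b))) \<notin> conn Tc"
  define C where "C = conn Tc `` {Lft (i, b)}"
  define Ls Rs where "Ls = {z \<in> edge_darts G. Lft z \<in> C}" and "Rs = {z \<in> edge_darts G. Rgt z \<in> C}"
  have "Tc \<subseteq> T" by (auto simp: Tc_def T_def set_smoothing_strands)
  then have sub: "C \<subseteq> conn T `` {Lft (i, b)}" unfolding C_def using conn_mono by blast
  have C: "x \<in> C \<longleftrightarrow> y \<in> C" if "(x, y) \<in> Tc" for x y
    using that conn_pair conn_sym conn_trans unfolding C_def by (metis Image_singleton_iff)
  have other: "Lft (i, \<not> b) \<notin> C" using sub assms(4) by blast
  have "(Lft (i, \<not> b), Rgt (across F (i, \<not> b))) \<in> conn T"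
    unfolding T_def by (rule conn_across) (use assms(3) in auto)
  then have other': "Rgt (across F (i, \<not> b)) \<notin> C"
    using sub assms(4) conn_sym conn_trans by (metis Image_singleton_iff subsetD)
  have turnC: "Lft z \<in> C \<longleftrightarrow> Rgt (turn G z) \<in> C" if "z \<in> edge_darts G" for z
    by (rule C) (use that in \<open>simp add: Tc_def\<close>)
  have acrossC: "Lft z \<in> C \<longleftrightarrow> Rgt (across F z) \<in> C"
    if "z \<in> edge_darts G" "z \<noteq> (i, b)" "z \<noteq> (i, \<not> b)" for z
  proof (rule C)
    have "z \<in> edge_darts G - {(i, False), (i, True)}" using that by (cases b) blast+
    then show "(Lft z, Rgt (across F z)) \<in> Tc" unfolding Tc_def by blast
  qed
  have LsI: "z \<in> Ls \<longleftrightarrow> z \<in> edge_darts G \<and> Lft z \<in> C"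
    and RsI: "z \<in> Rs \<longleftrightarrow> z \<in> edge_darts G \<and> Rgt z \<in> C" for z
    by (simp_all only: Ls_def Rs_def mem_Collect_eq)
  have "finite Ls" by (simp add: Ls_def)
  have "turn G ` Ls = Rs"
  proof (intro subset_antisym subsetI)
    fix w assume "w \<in> turn G ` Ls"
    then show "w \<in> Rs" using turnC turn_in_gdarts LsI RsI by blast
  next
    fix w assume "w \<in> Rs"
    then obtain z where "z \<in> edge_darts G" "w = turn G z" using gdarts_turnE RsI by metis
    with \<open>w \<in> Rs\<close> show "w \<in> turn G ` Ls" using turnC LsI RsI by blast
  qed
  moreover have "inj_on (turn G) Ls"
    by (rule inj_on_subset[OF bij_betw_imp_inj_on[OF turn_bij]]) (auto simp: Ls_def)
  ultimately have "card Rs = card Ls" using card_image by metis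
  moreover have "across F ` (Ls - {(i, b)}) = Rs"
  proof (intro subset_antisym subsetI)
    fix w assume "w \<in> across F ` (Ls - {(i, b)})"
    then obtain z where z: "z \<in> Ls" "z \<noteq> (i, b)" "w = across F z" by blast
    have "z \<noteq> (i, \<not> b)" using z(1) other LsI by blast
    then show "w \<in> Rs" using z acrossC[of z] LsI RsI across_in_gdarts by metis
  next
    fix w assume w: "w \<in> Rs"
    define z where "z = across F w"
    have wz: "w = across F z" unfolding z_def by (rule across_across[symmetric])
    have "Rgt (across F (i, b)) \<notin> C" using notin by (simp add: C_def)
    then have nz: "z \<noteq> (i, b)" "z \<noteq> (i, \<not> b)" using w other' wz RsI by metis+
    have "z \<in> edge_darts G" using w RsI unfolding z_def across_in_gdarts by blast
    then have "z \<in> Ls" using acrossC[of z] nz w wz RsI LsI by metis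
    then show "w \<in> across F ` (Ls - {(i, b)})" using nz wz by blast
  qed
  moreover have "inj_on (across F) (Ls - {(i, b)})" by (metis across_across inj_on_inverseI)
  ultimately have "card (Ls - {(i, b)}) = card Ls" using card_image by metis
  moreover have "(i, b) \<in> Ls" using assms(3) by (simp add: Ls_def C_def)
  ultimately show False using \<open>finite Ls\<close> card_Diff1_less by (metis less_irrefl)
qed

definition flip :: "nat \<Rightarrow> nat set \<Rightarrow> nat set" where
  "flip i F = (if i \<in> F then F - {i} else insert i F)"

lemma across_flip: "across (flip i F) z = (if fst z = i then across F (i, \<not> snd z) else across F z)"
  by (cases z) (auto simp: across_def flip_def)

text \<open>The two strands at the chosen edge lie on different circles. By \<open>conn_cut\<close>
  each of these circles stays in one piece when its strand at the edge is cut, and the other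
  smoothing reconnects the two pieces. So every old connection survives and two circles become
  one.\<close>

lemma ex_flip_circles_less:
  assumes "circles G F \<noteq> 1"
  obtains i where "i < num_edges G" "circles G (flip i F) < circles G F"
proof -
  obtain i where i: "i < num_edges G"
    and two: "(Lft (i, False), Lft (i, True)) \<notin> conn (set (smoothing_strands G F))"
    using ex_edge_two_circles[OF assms] .
  let ?T = "set (smoothing_strands G F)" and ?T' = "set (smoothing_strands G (flip i F))"
  let ?Tc = "(\<lambda>z. (Lft z, Rgt (across F z))) ` (edge_darts G - {(i, False), (i, True)})
      \<union> (\<lambda>z. (Lft z, Rgt (turn G z))) ` edge_darts G"
  have "?Tc \<subseteq> ?T'"
    unfolding set_smoothing_strands
  proof (rule Un_mono)
    show "(\<lambda>z. (Lft z, Rgt (across F z))) ` (edge_darts G - {(i, False), (i, True)})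
      \<subseteq> (\<lambda>z. (Lft z, Rgt (across (flip i F) z))) ` edge_darts G"
    proof (rule image_subsetI)
      fix z assume z: "z \<in> edge_darts G - {(i, False), (i, True)}"
      have "z = (i, True) \<or> z = (i, False)" if "fst z = i"
        using that by (cases "snd z") (simp_all add: prod_eq_iff)
      with z have "fst z \<noteq> i" by blast
      then have eq: "across (flip i F) z = across F z" by (simp add: across_flip)
      show "(Lft z, Rgt (across F z)) \<in> (\<lambda>z. (Lft z, Rgt (across (flip i F) z))) ` edge_darts G"
        by (rule image_eqI[where x = z]) (simp_all only: eq DiffD1[OF z])
    qed
  qed simp
  then have sub: "conn ?Tc \<subseteq> conn ?T'" by (rule conn_mono)
  have "(Lft (i, b), Lft (i, \<not> b)) \<notin> conn ?T" for b
    using two conn_sym[of "Lft (i, True)" "Lft (i, False)"] by (cases b) auto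
  from conn_cut[OF i this] have cut: "(Lft (i, b), Rgt (across F (i, b))) \<in> conn ?T'" for b
    using sub by blast
  have "(Lft (i, False), Rgt (across F (i, True))) \<in> conn ?T'"
    using conn_across[of "(i, False)" "flip i F"] i by (simp add: across_flip)
  then have join: "(Lft (i, False), Lft (i, True)) \<in> conn ?T'"
    using conn_sym[OF cut[of True]] by (rule conn_trans)
  have "conn ?T \<subseteq> conn ?T'"
  proof (rule conn_subset)
    fix x y assume "(x, y) \<in> ?T"
    then consider z where "z \<in> edge_darts G" "x = Lft z" "y = Rgt (across F z)" | "(x, y) \<in> ?Tc"
      unfolding set_smoothing_strands by blast
    then show "(x, y) \<in> conn ?T'"
    proof cases
      case (1 z)
      show ?thesis
      proof (cases "z \<in> {(i, False), (i, True)}")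
        case True
        then show ?thesis unfolding 1(2,3) using cut[of True] cut[of False] by blast
      next
        case False
        with 1(1) have "z \<in> edge_darts G - {(i, False), (i, True)}" by (rule DiffI)
        then have "(x, y) \<in> ?Tc" unfolding 1(2,3) by (intro UnI1 imageI)
        then show ?thesis by (intro subsetD[OF sub] conn_pair)
      qed
    next
      case 2
      then show ?thesis by (intro subsetD[OF sub] conn_pair)
    qed
  qed
  then have "circles G (flip i F) < circles G F"
    unfolding circles_def
    using join two i by (intro num_circles_less) (auto simp: Field_smoothing_strands)
  with i show thesis by (rule that)
qed

section \<open>Single-circle states are spanning trees\<close>

definition dart_vertex :: "nat \<times> bool \<Rightarrow> (nat \<times> bool) set" where
  "dart_vertex = vertex (graph_map G)"

definition dart_face :: "nat \<times> bool \<Rightarrow> (nat \<times> bool) set" where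
  "dart_face = face (graph_map G)"

lemma dart_vertex_turn: "z \<in> edge_darts G \<Longrightarrow> dart_vertex (turn G z) = dart_vertex z"
  unfolding dart_vertex_def vertex_def using orbit_step_on[OF turn_bij, of z] by (simp add: graph_map_def)

lemma dart_face_turn:
  assumes "z \<in> edge_darts G" shows "dart_face (fst (turn G z), \<not> snd (turn G z)) = dart_face z"
proof -
  have nc: "next_corner (graph_map G) w = (fst (turn G w), \<not> snd (turn G w))" for w
    by (simp add: next_corner_def graph_map_def case_prod_unfold)
  have e: "bij_betw (\<lambda>w. (fst w, \<not> snd w)) (edge_darts G) (edge_darts G)"
    by (rule bij_betw_byWitness[where f' = "\<lambda>w. (fst w, \<not> snd w)"]) auto
  have "next_corner (graph_map G) = (\<lambda>w. (fst w, \<not> snd w)) \<circ> turn G"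
    by (rule ext) (simp add: nc)
  then have "bij_betw (next_corner (graph_map G)) (edge_darts G) (edge_darts G)"
    using bij_betw_trans[OF turn_bij e] by simp
  then have "orbit (next_corner (graph_map G)) (next_corner (graph_map G) z)
      = orbit (next_corner (graph_map G)) z"
    by (rule orbit_step_on) (use assms in auto)
  then show ?thesis unfolding dart_face_def face_def nc .
qed

lemma card_vertices_faces: "card (dart_vertex ` edge_darts G) + card (dart_face ` edge_darts G) = num_edges G + 2"
proof -
  have darts: "darts (graph_map G) = edge_darts G" by (simp add: graph_map_def)
  have ne: "edge_darts G \<noteq> {}" using num_edges_pos by (auto simp: lessThan_empty_iff)
  have conn: "component (graph_map G) h = edge_darts G" if "h \<in> edge_darts G" for h
    using plane that unfolding plane_graph_def connected_map_def darts by blast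
  have "component (graph_map G) ` edge_darts G = {edge_darts G}"
    using ne conn by (auto simp: image_iff)
  then have comp: "card (component (graph_map G) ` edge_darts G) = 1" by simp
  have "(\<lambda>h. {h, edge (graph_map G) h}) ` edge_darts G = (\<lambda>i. {(i, False), (i, True)}) ` {..<num_edges G}"
    (is "?L = ?R")
  proof (intro subset_antisym image_subsetI)
    fix h assume "h \<in> edge_darts G"
    moreover have "{h, edge (graph_map G) h} = {(fst h, False), (fst h, True)}"
      by (cases h; cases "snd h") (auto simp: graph_map_def)
    ultimately show "{h, edge (graph_map G) h} \<in> ?R" by (auto simp: mem_Times_iff)
  next
    fix i assume "i \<in> {..<num_edges G}"
    then show "{(i, False), (i, True)} \<in> ?L"
      by (intro image_eqI[where x = "(i, False)"]) (auto simp: graph_map_def)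
  qed
  moreover have "card ?R = num_edges G"
    by (subst card_image) (auto simp: inj_on_def doubleton_eq_iff)
  ultimately have "card ((\<lambda>h. {h, edge (graph_map G) h}) ` edge_darts G) = num_edges G" by simp
  moreover have "planar_map (graph_map G)" using plane by (simp add: plane_graph_def)
  ultimately show ?thesis
    unfolding planar_map_def darts comp dart_vertex_def dart_face_def by simp
qed

definition edge_ends :: "nat set \<Rightarrow> ((nat \<times> bool) set \<times> (nat \<times> bool) set) set" where
  "edge_ends F = (\<lambda>i. (dart_vertex (i, False), dart_vertex (i, True))) ` F"

lemma joined_eq_conn: "joined G F = conn (edge_ends F)"
proof -
  have "{(vertex (graph_map G) (i, b), vertex (graph_map G) (i, \<not> b)) | i b. i \<in> F}
      = edge_ends F \<union> (edge_ends F)\<inverse>" (is "?L = ?R")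
  proof (intro subset_antisym subsetI)
    fix x assume "x \<in> ?L"
    then obtain i b where "i \<in> F" "x = (dart_vertex (i, b), dart_vertex (i, \<not> b))" by (auto simp: dart_vertex_def)
    then show "x \<in> ?R" by (cases b) (auto simp: edge_ends_def)
  next
    fix x assume "x \<in> ?R"
    then obtain i where "i \<in> F" "x = (dart_vertex (i, False), dart_vertex (i, \<not> False)) \<or> x = (dart_vertex (i, True), dart_vertex (i, \<not> True))"
      by (auto simp: edge_ends_def)
    then show "x \<in> ?L" unfolding dart_vertex_def by blast
  qed
  then show ?thesis by (simp add: joined_def conn_def)
qed

lemma all_labels_connected:
  assumes "circles G F = 1" "x \<in> Field (set (smoothing_strands G F))" "y \<in> Field (set (smoothing_strands G F))"
  shows "(x, y) \<in> conn (set (smoothing_strands G F))"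
proof -
  have "card ((\<lambda>a. conn (set (smoothing_strands G F)) `` {a}) ` Field (set (smoothing_strands G F))) = 1"
    using assms(1) by (simp add: circles_def num_circles_conn)
  then obtain c where "(\<lambda>a. conn (set (smoothing_strands G F)) `` {a}) ` Field (set (smoothing_strands G F)) = {c}"
    by (auto simp: card_1_singleton_iff)
  then show ?thesis using assms(2,3) conn_class_eq_iff by (metis imageI singletonD)
qed

fun label_vertex :: "strand_label \<Rightarrow> (nat \<times> bool) set" where
  "label_vertex (Lft z) = dart_vertex z"
| "label_vertex (Rgt z) = dart_vertex z"
| "label_vertex (Inner _ _ _) = {}"

text \<open>Each label lies beside a face of \<open>G\<close>. Left of \<open>z\<close> it is the
  face of the corner following \<open>z\<close>; right of \<open>z\<close> it is that of the corner
  preceding \<open>z\<close>, which \<open>dart_face_turn\<close> identifies with the face of the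
  opposite dart.\<close>

fun label_face :: "strand_label \<Rightarrow> (nat \<times> bool) set" where
  "label_face (Lft z) = dart_face z"
| "label_face (Rgt z) = dart_face (fst z, \<not> snd z)"
| "label_face (Inner _ _ _) = {}"

text \<open>The single circle visits every label. A strand around a corner stays at its vertex, and
  a strand at an edge moves to another vertex only along an edge of \<open>F\<close>.\<close>

lemma one_circle_vertices_joined:
  assumes "circles G F = 1" "x \<in> edge_darts G" "y \<in> edge_darts G"
  shows "(dart_vertex x, dart_vertex y) \<in> conn (edge_ends F)"
proof -
  have xy: "(Lft x, Lft y) \<in> conn (set (smoothing_strands G F))"
    by (rule all_labels_connected[OF assms(1)]) (use assms in \<open>simp_all add: Field_smoothing_strands\<close>)
  have "(label_vertex (Lft x), label_vertex (Lft y)) \<in> conn (edge_ends F)"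
  proof (rule conn_image[OF xy])
    fix a b assume "(a, b) \<in> set (smoothing_strands G F)"
    then consider z where "z \<in> edge_darts G" "a = Lft z" "b = Rgt (across F z)"
      | z where "z \<in> edge_darts G" "a = Lft z" "b = Rgt (turn G z)"
      unfolding set_smoothing_strands by blast
    then show "(label_vertex a, label_vertex b) \<in> conn (edge_ends F)"
    proof cases
      case (1 z)
      show ?thesis
      proof (cases "fst z \<in> F")
        case True
        then have e: "(dart_vertex (fst z, False), dart_vertex (fst z, True)) \<in> conn (edge_ends F)"
          by (intro conn_pair) (simp add: edge_ends_def)
        show ?thesis
          using 1 True e conn_sym[OF e] by (cases z; cases "snd z") (auto simp: across_def)
      next
        case False
        then show ?thesis using 1 by (simp add: across_def)
      qed
    next
      case (2 z)
      then show ?thesis using dart_vertex_turn by simp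
    qed
  qed
  then show ?thesis by simp
qed

text \<open>The dual of the preceding argument: a strand at a merged edge stays beside its face, and
  a strand at a separated edge goes around to the face on the other side, that is, along the dual
  edge.\<close>

lemma one_circle_faces_joined:
  assumes "circles G F = 1" "x \<in> edge_darts G" "y \<in> edge_darts G"
  shows "(dart_face x, dart_face y) \<in> conn ((\<lambda>i. (dart_face (i, False), dart_face (i, True))) ` ({..<num_edges G} - F))"
proof -
  let ?E = "(\<lambda>i. (dart_face (i, False), dart_face (i, True))) ` ({..<num_edges G} - F)"
  have xy: "(Lft x, Lft y) \<in> conn (set (smoothing_strands G F))"
    by (rule all_labels_connected[OF assms(1)]) (use assms in \<open>simp_all add: Field_smoothing_strands\<close>)
  have "(label_face (Lft x), label_face (Lft y)) \<in> conn ?E"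
  proof (rule conn_image[OF xy])
    fix a b assume "(a, b) \<in> set (smoothing_strands G F)"
    then consider z where "z \<in> edge_darts G" "a = Lft z" "b = Rgt (across F z)"
      | z where "z \<in> edge_darts G" "a = Lft z" "b = Rgt (turn G z)"
      unfolding set_smoothing_strands by blast
    then show "(label_face a, label_face b) \<in> conn ?E"
    proof cases
      case (1 z)
      show ?thesis
      proof (cases "fst z \<in> F")
        case False
        then have "fst z \<in> {..<num_edges G} - F" using 1(1) by (cases z) auto
        then have e: "(dart_face (fst z, False), dart_face (fst z, True)) \<in> conn ?E"
          by (intro conn_pair imageI)
        show ?thesis
          using 1 False e conn_sym[OF e] by (cases z; cases "snd z") (auto simp: across_def)
      next
        case True
        then show ?thesis using 1 by (simp add: across_def)
      qed
    next
      case (2 z)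
      then show ?thesis using dart_face_turn by simp
    qed
  qed
  then show ?thesis by simp
qed

text \<open>The duals of the edges outside \<open>F\<close> join all faces, so there are at most
  \<open>num_edges G - card F + 1\<close> of them, and Euler's formula leaves at least
  \<open>card F + 1\<close> vertices. If an edge of \<open>F\<close> lay on a cycle in
  \<open>F\<close>, the other \<open>card F - 1\<close> edges would still join all vertices, which
  allows only \<open>card F\<close> of them.\<close>

lemma one_circle_spanning_tree:
  assumes one: "circles G F = 1" and F: "F \<subseteq> {..<num_edges G}"
  shows "spanning_tree G F"
proof -
  have fin: "finite F" using F finite_subset by blast
  have darts: "darts (graph_map G) = edge_darts G" by (simp add: graph_map_def)
  have le: "card (edge_ends A) \<le> card A" if "finite A" for A
    unfolding edge_ends_def by (rule card_image_le[OF that])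
  let ?E = "(\<lambda>i. (dart_face (i, False), dart_face (i, True))) ` ({..<num_edges G} - F)"
  have "card (dart_face ` edge_darts G) \<le> card ?E + 1"
    by (rule card_le_conn) (use one_circle_faces_joined[OF one] in auto)
  also have "card ?E \<le> card ({..<num_edges G} - F)" by (rule card_image_le) simp
  also have "\<dots> = num_edges G - card F" using F by (simp add: card_Diff_subset fin)
  finally have "card (dart_face ` edge_darts G) \<le> num_edges G - card F + 1" by simp
  moreover have "card F \<le> num_edges G" using card_mono[OF _ F] by simp
  ultimately have V: "card (dart_vertex ` edge_darts G) \<ge> card F + 1"
    using card_vertices_faces by linarith
  have "(dart_vertex (i, False), dart_vertex (i, True)) \<notin> conn (edge_ends (F - {i}))" if i: "i \<in> F" for i
  proof
    assume ends: "(dart_vertex (i, False), dart_vertex (i, True)) \<in> conn (edge_ends (F - {i}))"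
    have "conn (edge_ends F) \<subseteq> conn (edge_ends (F - {i}))"
    proof (rule conn_subset)
      fix a b assume "(a, b) \<in> edge_ends F"
      then obtain j where j: "j \<in> F" "a = dart_vertex (j, False)" "b = dart_vertex (j, True)"
        by (auto simp: edge_ends_def)
      show "(a, b) \<in> conn (edge_ends (F - {i}))"
      proof (cases "j = i")
        case True
        then show ?thesis using ends j by simp
      next
        case False
        then show ?thesis using j by (intro conn_pair) (simp add: edge_ends_def)
      qed
    qed
    then have "card (dart_vertex ` edge_darts G) \<le> card (edge_ends (F - {i})) + 1"
      by (intro card_le_conn)
        (use fin one_circle_vertices_joined[OF one] in \<open>auto simp: edge_ends_def\<close>)
    also have "card (edge_ends (F - {i})) \<le> card (F - {i})" by (rule le) (use fin in simp)
    also have "\<dots> = card F - 1" using i fin by simp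
    finally have "card (dart_vertex ` edge_darts G) \<le> card F - 1 + 1" by simp
    moreover have "card F > 0" using i fin by (auto simp: card_gt_0_iff)
    ultimately show False using V by linarith
  qed
  then show ?thesis
    unfolding spanning_tree_def joined_eq_conn darts
    using F one_circle_vertices_joined[OF one] by (simp add: dart_vertex_def)
qed

text \<open>The set on the right consists of the edges whose coefficient in the state
  \<open>F\<close> is \<open>turned_coeff\<close>, so the weight counts the denominators d of that
  state.\<close>

lemma tree_weight_eq:
  assumes "F \<subseteq> {..<num_edges G}"
  shows "tree_weight G F = card {i \<in> {..<num_edges G}. (i \<in> F) \<noteq> (color G i = Col_c)}"
proof -
  let ?A = "{i \<in> F. color G i = Col_s}" and ?B = "{i \<in> {..<num_edges G} - F. color G i = Col_c}"
  have fin: "finite F" using assms finite_subset by blast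
  have "card (?A \<union> ?B) = card ?A + card ?B"
    by (rule card_Un_disjoint) (use fin in auto)
  moreover have "color G i = Col_s \<longleftrightarrow> color G i \<noteq> Col_c" for i by (cases "color G i") auto
  then have "?A \<union> ?B = {i \<in> {..<num_edges G}. (i \<in> F) \<noteq> (color G i = Col_c)}"
    using assms by auto
  ultimately show ?thesis by (simp add: tree_weight_def)
qed

lemma flip_subset: "F \<subseteq> {..<n} \<Longrightarrow> i < n \<Longrightarrow> flip i F \<subseteq> {..<n}"
  by (auto simp: flip_def)

lemma tree_weight_flip:
  assumes "F \<subseteq> {..<num_edges G}" "i < num_edges G"
  shows "tree_weight G F \<le> tree_weight G (flip i F) + 1"
proof -
  let ?S = "\<lambda>F. {j \<in> {..<num_edges G}. (j \<in> F) \<noteq> (color G j = Col_c)}"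
  have "card (?S F) \<le> card (insert i (?S (flip i F)))"
    by (rule card_mono) (auto simp: flip_def split: if_splits)
  also have "\<dots> \<le> card (?S (flip i F)) + 1"
    by (simp add: card_insert_if)
  finally show ?thesis using assms by (simp add: tree_weight_eq flip_subset)
qed

lemma tree_weight_le:
  assumes "F \<subseteq> {..<num_edges G}"
  shows "tree_weight G F + 1 \<le> Max {tree_weight G F | F. spanning_tree G F} + circles G F"
  using assms
proof (induction "circles G F" arbitrary: F rule: less_induct)
  case less
  show ?case
  proof (cases "circles G F = 1")
    case True
    have "{tree_weight G F | F. spanning_tree G F} \<subseteq> tree_weight G ` Pow {..<num_edges G}"
      by (auto simp: spanning_tree_def)
    then have "finite {tree_weight G F | F. spanning_tree G F}" by (rule finite_subset) simp
    then have "tree_weight G F \<le> Max {tree_weight G F | F. spanning_tree G F}"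
      by (rule Max_ge) (use one_circle_spanning_tree[OF True less.prems] in blast)
    then show ?thesis using True by simp
  next
    case False
    then obtain i where i: "i < num_edges G" "circles G (flip i F) < circles G F"
      by (rule ex_flip_circles_less)
    have "tree_weight G F \<le> tree_weight G (flip i F) + 1"
      using less.prems i(1) by (rule tree_weight_flip)
    then show ?thesis
      using less.hyps[OF i(2) flip_subset[OF less.prems i(1)]] i(2) by linarith
  qed
qed

text \<open>There are \<open>4 * num_edges G\<close> labels, two for each dart. A circle through
  \<open>Lft z\<close> contains \<open>Rgt (across F z)\<close> and \<open>Rgt (turn G z)\<close>;
  if these differ, it also contains a second left label and so at least four labels. If this
  happened for all \<open>z\<close>, there would be at most \<open>num_edges G\<close>
  circles.\<close>

lemma short_circle:
  assumes "circles G F > num_edges G"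
  obtains z where "z \<in> edge_darts G" "across F z = turn G z"
proof (rule ccontr)
  assume "\<not> thesis"
  with that have ne: "across F z \<noteq> turn G z" if "z \<in> edge_darts G" for z using \<open>z \<in> edge_darts G\<close> by blast
  let ?T = "conn (set (smoothing_strands G F))" and ?L = "Lft ` edge_darts G \<union> Rgt ` edge_darts G"
  let ?cl = "(\<lambda>a. ?T `` {a}) ` ?L"
  have fin: "finite ?L" by simp
  have sub: "?T `` {a} \<subseteq> ?L" if "a \<in> ?L" for a
  proof
    fix x assume "x \<in> ?T `` {a}"
    then have "(a, x) \<in> ?T" by simp
    from conn_Field[OF this] that show "x \<in> ?L" by (simp only: Field_smoothing_strands)
  qed
  have four: "4 \<le> card (?T `` {Lft z})" if z: "z \<in> edge_darts G" for z
  proof -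
    define w where "w = across F (turn G z)"
    have tz: "turn G z \<in> edge_darts G" using z by (rule turn_in_gdarts)
    then have w: "w \<in> edge_darts G" unfolding w_def across_in_gdarts .
    have "w \<noteq> z" using ne[OF z] across_across unfolding w_def by metis
    have "(Lft w, Rgt (turn G z)) \<in> ?T" using conn_across[OF w, of F] by (simp add: w_def)
    then have "(Lft z, Lft w) \<in> ?T" using conn_turn[OF z, of F] conn_sym conn_trans by metis
    then have "{Lft z, Lft w, Rgt (across F z), Rgt (turn G z)} \<subseteq> ?T `` {Lft z}"
      using conn_across[OF z, of F] conn_turn[OF z, of F] by simp
    moreover have "finite (?T `` {Lft z})" using z by (intro finite_subset[OF sub fin] UnI1 imageI)
    ultimately have "card {Lft z, Lft w, Rgt (across F z), Rgt (turn G z)} \<le> card (?T `` {Lft z})"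
      by (intro card_mono)
    moreover have "card {Lft z, Lft w, Rgt (across F z), Rgt (turn G z)} = 4"
      using ne[OF z] \<open>w \<noteq> z\<close> by auto
    ultimately show ?thesis by simp
  qed
  have rep: "\<exists>z\<in>edge_darts G. c = ?T `` {Lft z}" if "c \<in> ?cl" for c
  proof -
    from that obtain a where a: "a \<in> ?L" "c = ?T `` {a}" by blast
    then consider z where "z \<in> edge_darts G" "a = Lft z" | z where "z \<in> edge_darts G" "a = Rgt z" by blast
    then show ?thesis
    proof cases
      case (1 z)
      then show ?thesis using a by blast
    next
      case (2 z)
      have w: "across F z \<in> edge_darts G" using 2(1) unfolding across_in_gdarts .
      have "(a, Lft (across F z)) \<in> ?T" using conn_sym[OF conn_across[OF w, of F]] 2 by simp
      then show ?thesis using a(2) w conn_class_eq_iff by metis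
    qed
  qed
  have "4 * card ?cl = (\<Sum>c\<in>?cl. 4)" by simp
  also have "\<dots> \<le> (\<Sum>c\<in>?cl. card c)"
    by (rule sum_mono) (use rep four in metis)
  also have "\<dots> = card (\<Union>?cl)"
  proof (rule card_Union_disjoint[symmetric])
    show "pairwise disjnt ?cl"
    proof (intro pairwiseI)
      fix c c' assume "c \<in> ?cl" "c' \<in> ?cl" "c \<noteq> c'"
      then obtain a b where ab: "c = ?T `` {a}" "c' = ?T `` {b}" by blast
      show "disjnt c c'"
      proof (rule ccontr)
        assume "\<not> disjnt c c'"
        then obtain e where "(a, e) \<in> ?T" "(b, e) \<in> ?T" unfolding ab disjnt_def by blast
        then have "(a, b) \<in> ?T" using conn_sym conn_trans by metis
        then show False using \<open>c \<noteq> c'\<close> ab conn_class_eq_iff by metis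
      qed
    qed
    show "finite c" if c: "c \<in> ?cl" for c
    proof -
      obtain a where "c = ?T `` {a}" "a \<in> ?L" using c by (rule imageE)
      then show ?thesis using finite_subset[OF sub fin] by simp
    qed
  qed
  also have "\<dots> \<le> card ?L"
    by (rule card_mono[OF fin], rule UN_least, rule sub)
  also have "\<dots> = 4 * num_edges G"
  proof -
    have "card ?L = card (Lft ` edge_darts G) + card (Rgt ` edge_darts G)"
      by (rule card_Un_disjoint) auto
    also have "card (Lft ` edge_darts G) = card (edge_darts G)" by (rule card_image) (simp add: inj_on_def)
    also have "card (Rgt ` edge_darts G) = card (edge_darts G)" by (rule card_image) (simp add: inj_on_def)
    finally show ?thesis by (simp add: card_cartesian_product card_UNIV_bool)
  qed
  finally have "circles G F \<le> num_edges G"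
    unfolding circles_def num_circles_conn Field_smoothing_strands by simp
  with assms show False by simp
qed

definition max_tree_weight :: nat where
  "max_tree_weight = Max {tree_weight G F | F. spanning_tree G F}"

text \<open>The edges colored \<open>Col_s\<close> form the state that turns back at every edge, so
  its weight is \<open>num_edges G\<close>. The short circle found there surrounds a vertex of
  degree 1 if its edge is colored \<open>Col_c\<close>, and runs inside a loop bounding a face if it
  is colored \<open>Col_s\<close>.\<close>

lemma monogon_if_max_tree_weight_0:
  assumes "max_tree_weight = 0"
  obtains i b where "i < num_edges G"
    "turn G (i, b) = (i, if color G i = Col_c then b else \<not> b)"
proof -
  define F where "F = {i. i < num_edges G \<and> color G i = Col_s}"
  have F: "F \<subseteq> {..<num_edges G}" by (auto simp: F_def)
  have s: "color G i = Col_s \<longleftrightarrow> color G i \<noteq> Col_c" for i by (cases "color G i") auto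
  have "{i \<in> {..<num_edges G}. (i \<in> F) \<noteq> (color G i = Col_c)} = {..<num_edges G}"
    using s by (auto simp: F_def)
  then have "tree_weight G F = num_edges G" using tree_weight_eq[OF F] by simp
  then have "circles G F > num_edges G"
    using tree_weight_le[OF F] assms by (simp add: max_tree_weight_def)
  then obtain z where z: "z \<in> edge_darts G" "across F z = turn G z" by (rule short_circle)
  obtain i b where ib: "z = (i, b)" by (cases z)
  have i: "i < num_edges G" using z ib by simp
  then have "turn G (i, b) = (i, if color G i = Col_c then b else \<not> b)"
    using z(2) s[of i] by (auto simp: ib across_def F_def)
  with i show thesis by (rule that)
qed

end

section \<open>Monogons in the original diagram\<close>

lemma other_end:
  assumes "link_diagram D" "h \<in> half_edges D"
  shows "other_end D h \<in> half_edges D" "other_end D (other_end D h) = h"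
proof -
  let ?P = "\<lambda>h h'. h' \<in> half_edges D \<and> h' \<noteq> h \<and> label D h' = label D h"
  have ex: "\<exists>!h'. ?P g h'" if "g \<in> half_edges D" for g
    using assms(1) that unfolding link_diagram_def by blast
  have P: "?P g (other_end D g)" if "g \<in> half_edges D" for g
    unfolding other_end_def by (rule theI'[OF ex[OF that]])
  show mem: "other_end D h \<in> half_edges D" using P[OF assms(2)] by blast
  show "other_end D (other_end D h) = h"
  proof -
    have "?P (other_end D h) h" using P[OF assms(2)] assms(2) by metis
    with P[OF mem] ex[OF mem] show ?thesis by blast
  qed
qed

lemma length_slots_arc_free:
  assumes "arc_free D" "j < length D" shows "length (slots (D ! j)) = 4"
proof -
  have "is_crossing (D ! j)" using assms by (simp add: arc_free_def)
  then show ?thesis by (cases "D ! j") auto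
qed

lemma reduced_diagram_no_monogon:
  fixes D :: "'a diagram"
  assumes D: "link_diagram D" "arc_free D" "reduced_diagram D"
    and h: "j < length D" "i < 4"
  shows "other_end D (j, i) \<noteq> (j, Suc i mod 4)" "other_end D (j, i) \<noteq> (j, (i + 3) mod 4)"
proof -
  have half: "(j, l) \<in> half_edges D" if "l < 4" for l
    using h(1) that by (simp add: half_edges_def length_slots_arc_free[OF D(2)])
  have nc: "next_corner (diagram_map D) (j, l) = other_end D (j, Suc l mod 4)" for l
    using length_slots_arc_free[OF D(2) h(1)] by (simp add: next_corner_def diagram_map_def)
  have red: "other_end D (j, Suc l mod 4) \<noteq> (j, l)" if "l < 4" for l
    using D(3) half[OF that] unfolding reduced_diagram_def nc[symmetric] by blast
  show "other_end D (j, i) \<noteq> (j, Suc i mod 4)"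
    using red[OF h(2)] other_end(2)[OF D(1) half[OF h(2)]] by metis
  have "Suc ((i + 3) mod 4) mod 4 = i" using h(2) by presburger
  then show "other_end D (j, i) \<noteq> (j, (i + 3) mod 4)" using red[of "(i + 3) mod 4"] by simp
qed

text \<open>Undoing the collapse, the short circle yields a dart \<open>h\<close> at an end of the
  chain or sheaf: a vertex of degree 1 gives \<open>rot h = h\<close> for a chain, and a loop
  bounding a face gives \<open>rot h = edge h\<close> for a sheaf. Either way a strand leaves a
  crossing and returns to a neighbouring end of it, which a reduced diagram excludes.\<close>

lemma max_tree_weight_pos:
  fixes D :: "'a diagram"
  assumes D: "link_diagram D" "arc_free D" "reduced_diagram D"
    and S: "checkerboard D out S" and G: "colored_graph_of D S G" "num_edges G \<ge> 1"
  shows "Max {tree_weight G F | F. spanning_tree G F} \<ge> 1"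
proof (rule ccontr)
  assume neg: "\<not> Max {tree_weight G F | F. spanning_tree G F} \<ge> 1"
  interpret plane_colored_graph G
    using G by unfold_locales (auto simp: colored_graph_of_def)
  have "max_tree_weight = 0" using neg by (simp add: max_tree_weight_def)
  then obtain i b where i: "i < num_edges G"
    and turn: "turn G (i, b) = (i, if color G i = Col_c then b else \<not> b)"
    by (rule monogon_if_max_tree_weight_0)
  let ?M = "signed_graph D S"
  obtain xs where xs: "\<forall>i<num_edges G. set (xs i) \<subseteq> darts ?M
        \<and> (\<forall>h\<in>set (xs i). \<forall>h'\<in>set (xs i). positive ?M h = positive ?M h')
        \<and> (length (xs i) = 1 \<or> (case color G i of Col_c \<Rightarrow> chain ?M (xs i) | Col_s \<Rightarrow> sheaf ?M (xs i)))"
    and rot: "\<forall>(i, b)\<in>darts (graph_map G). rot ?M (last_dart ?M (color G i) (xs i) b)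
        = (case turn G (i, b) of (i', b') \<Rightarrow> first_dart ?M (xs i') b')"
    using G(1) unfolding colored_graph_of_def Let_def by blast
  have sub: "set (xs i) \<subseteq> S" using xs i by (simp add: signed_graph_def)
  have ne: "xs i \<noteq> []"
    using xs i by (cases "color G i") (auto simp: chain_def sheaf_def)
  have dart: "fst h < length D \<and> snd h < 4" if "h \<in> set (xs i)" for h
  proof -
    have "h \<in> half_edges D" using that sub S by (auto simp: checkerboard_def)
    moreover have "length (slots x) \<le> 4" for x :: "'a node" by (cases x) auto
    ultimately show ?thesis by (cases h) (auto simp: half_edges_def intro: less_le_trans)
  qed
  have "(i, b) \<in> darts (graph_map G)" using i by (simp add: graph_map_def)
  then have r: "rot ?M (last_dart ?M (color G i) (xs i) b)
      = first_dart ?M (xs i) (if color G i = Col_c then b else \<not> b)"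
    using rot turn by auto
  have rotM: "rot ?M h = (fst (other_end D h), (snd (other_end D h) + 3) mod 4)" for h
    by (simp add: signed_graph_def case_prod_unfold)
  have edgeM: "edge ?M h = (fst h, (snd h + 2) mod 4)" for h
    by (simp add: signed_graph_def case_prod_unfold)
  have oe_lt: "snd (other_end D (j, l)) < 4" if "j < length D" "l < 4" for j l
  proof -
    have "(j, l) \<in> half_edges D"
      using that length_slots_arc_free[OF D(2)] by (simp add: half_edges_def)
    then have "other_end D (j, l) \<in> half_edges D" by (rule other_end(1)[OF D(1)])
    then show ?thesis
      using length_slots_arc_free[OF D(2)] by (cases "other_end D (j, l)") (auto simp: half_edges_def)
  qed
  \<comment> \<open>\<open>rot\<close> adds 3 modulo 4 to the position where the strand arrives. The
    values \<open>l\<close> and \<open>l + 2\<close> therefore mean arrival at \<open>l + 1\<close>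
    or \<open>l + 3\<close>, the two ends next to \<open>l\<close>.\<close>
  have key: False if jl: "j < length D" "l < 4"
    and "rot ?M (j, l) = (j, l) \<or> rot ?M (j, l) = (j, (l + 2) mod 4)" for j l
  proof -
    let ?m = "snd (other_end D (j, l))"
    have m: "?m < 4" using oe_lt[OF jl] .
    have "fst (other_end D (j, l)) = j" using that(3) by (auto simp: rotM)
    moreover have "(?m + 3) mod 4 = l \<or> (?m + 3) mod 4 = (l + 2) mod 4" using that(3) by (auto simp: rotM)
    then have "?m = Suc l mod 4 \<or> ?m = (l + 3) mod 4"
    proof -
      have "l \<in> {0, 1, 2, 3}" "?m \<in> {0, 1, 2, 3}" using m jl(2) by auto
      with \<open>(?m + 3) mod 4 = l \<or> _\<close> show ?thesis by auto
    qed
    ultimately have "other_end D (j, l) = (j, Suc l mod 4) \<or> other_end D (j, l) = (j, (l + 3) mod 4)"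
      by (metis prod.collapse)
    then show False using reduced_diagram_no_monogon[OF D jl] by blast
  qed
  have last: "last (xs i) \<in> set (xs i)" and hd: "hd (xs i) \<in> set (xs i)" using ne by auto
  define h where "h = last_dart ?M (color G i) (xs i) b"
  have ee: "edge ?M (edge ?M g) = g" if "g \<in> set (xs i)" for g
    using dart[OF that] by (cases g) (simp add: edgeM mod_simps)
  have h_cases: "\<exists>g\<in>set (xs i). h = g \<or> h = edge ?M g"
    using last hd by (auto simp: h_def last_dart_def split: color.splits)
  then have "fst h < length D \<and> snd h < 4" using dart by (auto simp: edgeM)
  moreover have "rot ?M h = h \<or> rot ?M h = edge ?M h"
    using r ee[OF last] ee[OF hd]
    by (cases "color G i"; cases b) (auto simp: h_def last_dart_def first_dart_def)
  ultimately show False using key[of "fst h" "snd h"] by (simp add: edgeM)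
qed

section \<open>Laurent polynomials with integer coefficients\<close>

lemma laurent_eq_sum_single: "f = (\<Sum>n\<in>Poly_Mapping.keys f. Poly_Mapping.single n (Poly_Mapping.lookup f n))"
  by (rule poly_mapping_eqI) (simp add: lookup_sum lookup_single when_def in_keys_iff)

lemma laurent_induct [case_names zero single add]:
  fixes f :: "int laurent"
  assumes "P 0" "\<And>n a. P (Poly_Mapping.single n a)" "\<And>f g. P f \<Longrightarrow> P g \<Longrightarrow> P (f + g)"
  shows "P f"
proof -
  have "P (\<Sum>n\<in>A. Poly_Mapping.single n (Poly_Mapping.lookup f n))" if "finite A" for A
    using that by induction (auto simp: assms)
  then show ?thesis by (subst laurent_eq_sum_single) simp
qed

definition int_eval :: "complex \<Rightarrow> int laurent \<Rightarrow> complex" where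
  "int_eval z f = (\<Sum>n\<in>Poly_Mapping.keys f. of_int (Poly_Mapping.lookup f n) * z powi n)"

text \<open>The l1 norm of the coefficients. Unlike the L2 norm it is submultiplicative, and it
  bounds the L2 norm from above.\<close>

definition coeff_sum :: "int laurent \<Rightarrow> int" where
  "coeff_sum f = (\<Sum>n\<in>Poly_Mapping.keys f. \<bar>Poly_Mapping.lookup f n\<bar>)"

lemma int_eval_eq_sum:
  assumes "finite A" "Poly_Mapping.keys f \<subseteq> A"
  shows "int_eval z f = (\<Sum>n\<in>A. of_int (Poly_Mapping.lookup f n) * z powi n)"
  unfolding int_eval_def by (rule sum.mono_neutral_left) (use assms in \<open>auto simp: in_keys_iff\<close>)

lemma coeff_sum_eq_sum:
  assumes "finite A" "Poly_Mapping.keys f \<subseteq> A"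
  shows "coeff_sum f = (\<Sum>n\<in>A. \<bar>Poly_Mapping.lookup f n\<bar>)"
  unfolding coeff_sum_def by (rule sum.mono_neutral_left) (use assms in \<open>auto simp: in_keys_iff\<close>)

lemma int_eval_0 [simp]: "int_eval z 0 = 0"
  by (simp add: int_eval_def)

lemma int_eval_single [simp]: "int_eval z (Poly_Mapping.single n a) = of_int a * z powi n"
  by (simp add: int_eval_def)

lemma int_eval_1 [simp]: "int_eval z 1 = 1"
  using int_eval_single[of z 0 1] by (simp flip: single_one)

lemma int_eval_add [simp]: "int_eval z (f + g) = int_eval z f + int_eval z g"
proof -
  let ?A = "Poly_Mapping.keys f \<union> Poly_Mapping.keys g"
  have "Poly_Mapping.keys (f + g) \<subseteq> ?A" by (rule Poly_Mapping.keys_add)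
  then show ?thesis
    by (simp add: int_eval_eq_sum[of ?A] lookup_add algebra_simps sum.distrib)
qed

lemma int_eval_uminus [simp]: "int_eval z (- f) = - int_eval z f"
  using int_eval_add[of z f "- f"] by (simp add: eq_neg_iff_add_eq_0 add.commute)

lemma int_eval_diff [simp]: "int_eval z (f - g) = int_eval z f - int_eval z g"
  using int_eval_add[of z f "- g"] by simp

lemma int_eval_mult [simp]:
  assumes "z \<noteq> 0" shows "int_eval z (f * g) = int_eval z f * int_eval z g"
proof (induction f rule: laurent_induct)
  case (single n a)
  show ?case
    by (induction g rule: laurent_induct)
      (use assms in \<open>simp_all add: mult_single power_int_add algebra_simps\<close>)
qed (simp_all add: algebra_simps)

lemma int_eval_power [simp]: "z \<noteq> 0 \<Longrightarrow> int_eval z (f ^ n) = int_eval z f ^ n"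
  by (induction n) auto

lemma lookup_complex_laurent: "Poly_Mapping.lookup (complex_laurent f) n = of_int (Poly_Mapping.lookup f n)"
  by (simp add: complex_laurent_def Poly_Mapping.map.rep_eq when_def)

lemma keys_complex_laurent [simp]: "Poly_Mapping.keys (complex_laurent f) = Poly_Mapping.keys f"
  by (auto simp: in_keys_iff lookup_complex_laurent)

lemma complex_laurent_eq_0_iff [simp]: "complex_laurent f = 0 \<longleftrightarrow> f = 0"
  by (metis keys_complex_laurent keys_eq_empty)

lemma laurent_eval_complex_laurent: "laurent_eval (complex_laurent f) z = int_eval z f"
  by (simp add: laurent_eval_def int_eval_def lookup_complex_laurent)

lemma coeff_sum_nonneg: "coeff_sum f \<ge> 0"
  by (simp add: coeff_sum_def sum_nonneg)

lemma coeff_sum_0 [simp]: "coeff_sum 0 = 0"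
  by (simp add: coeff_sum_def)

lemma coeff_sum_single [simp]: "coeff_sum (Poly_Mapping.single n a) = \<bar>a\<bar>"
  by (simp add: coeff_sum_def)

lemma coeff_sum_1 [simp]: "coeff_sum 1 = 1"
  using coeff_sum_single[of 0 1] by (simp flip: single_one)

lemma coeff_sum_add: "coeff_sum (f + g) \<le> coeff_sum f + coeff_sum g"
proof -
  let ?A = "Poly_Mapping.keys f \<union> Poly_Mapping.keys g"
  have "Poly_Mapping.keys (f + g) \<subseteq> ?A" by (rule Poly_Mapping.keys_add)
  then have "coeff_sum (f + g) = (\<Sum>n\<in>?A. \<bar>Poly_Mapping.lookup f n + Poly_Mapping.lookup g n\<bar>)"
    by (simp add: coeff_sum_eq_sum[of ?A] lookup_add)
  also have "\<dots> \<le> (\<Sum>n\<in>?A. \<bar>Poly_Mapping.lookup f n\<bar> + \<bar>Poly_Mapping.lookup g n\<bar>)"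
    by (intro sum_mono abs_triangle_ineq)
  also have "\<dots> = coeff_sum f + coeff_sum g"
    by (simp add: coeff_sum_eq_sum[of ?A] sum.distrib)
  finally show ?thesis .
qed

lemma coeff_sum_uminus [simp]: "coeff_sum (- f) = coeff_sum f"
  by (simp add: coeff_sum_def)

lemma coeff_sum_sum: "coeff_sum (sum f A) \<le> (\<Sum>x\<in>A. coeff_sum (f x))"
proof (induction A rule: infinite_finite_induct)
  case (insert x A)
  then show ?case using coeff_sum_add[of "f x" "sum f A"] by simp
qed auto

lemma coeff_sum_mult: "coeff_sum (f * g) \<le> coeff_sum f * coeff_sum g"
proof -
  let ?f = "Poly_Mapping.lookup f" and ?g = "Poly_Mapping.lookup g"
  have "f * g = (\<Sum>n\<in>Poly_Mapping.keys f. Poly_Mapping.single n (?f n))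
      * (\<Sum>m\<in>Poly_Mapping.keys g. Poly_Mapping.single m (?g m))"
    by (rule arg_cong2[where f = "(*)"]) (rule laurent_eq_sum_single)+
  also have "\<dots> = (\<Sum>n\<in>Poly_Mapping.keys f. \<Sum>m\<in>Poly_Mapping.keys g. Poly_Mapping.single (n + m) (?f n * ?g m))"
    by (simp add: sum_product mult_single)
  finally have "coeff_sum (f * g)
      = coeff_sum (\<Sum>n\<in>Poly_Mapping.keys f. \<Sum>m\<in>Poly_Mapping.keys g. Poly_Mapping.single (n + m) (?f n * ?g m))"
    by (rule arg_cong)
  also have "\<dots> \<le> (\<Sum>n\<in>Poly_Mapping.keys f. coeff_sum (\<Sum>m\<in>Poly_Mapping.keys g.
      Poly_Mapping.single (n + m) (?f n * ?g m)))"
    by (rule coeff_sum_sum)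
  also have "\<dots> \<le> (\<Sum>n\<in>Poly_Mapping.keys f. \<Sum>m\<in>Poly_Mapping.keys g. \<bar>?f n * ?g m\<bar>)"
    by (intro sum_mono order_trans[OF coeff_sum_sum]) simp
  also have "\<dots> = coeff_sum f * coeff_sum g"
    by (simp add: coeff_sum_def sum_product abs_mult)
  finally show ?thesis .
qed

lemma coeff_sum_mult_le:
  assumes "coeff_sum f \<le> a" "coeff_sum g \<le> b" shows "coeff_sum (f * g) \<le> a * b"
proof -
  have "coeff_sum f * coeff_sum g \<le> a * b"
    by (intro mult_mono) (use assms coeff_sum_nonneg[of f] coeff_sum_nonneg[of g] in auto)
  then show ?thesis using coeff_sum_mult[of f g] by linarith
qed

lemma coeff_sum_power: "coeff_sum (f ^ n) \<le> coeff_sum f ^ n"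
proof (induction n)
  case (Suc n)
  then show ?case using coeff_sum_mult_le[of f "coeff_sum f" "f ^ n" "coeff_sum f ^ n"] by simp
qed simp

lemma coeff_sum_prod: "coeff_sum (prod f A) \<le> (\<Prod>x\<in>A. coeff_sum (f x))"
proof (induction A rule: infinite_finite_induct)
  case (insert x A)
  then show ?case using coeff_sum_mult_le[of "f x" _ "prod f A"] by simp
qed auto

lemma l2_norm_le_coeff_sum: "l2_norm (complex_laurent f) \<le> of_int (coeff_sum f)"
proof -
  have "l2_norm (complex_laurent f) = L2_set (\<lambda>n. of_int \<bar>Poly_Mapping.lookup f n\<bar>) (Poly_Mapping.keys f)"
    by (simp add: l2_norm_def L2_set_def lookup_complex_laurent)
  also have "\<dots> \<le> (\<Sum>n\<in>Poly_Mapping.keys f. of_int \<bar>Poly_Mapping.lookup f n\<bar>)"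
    by (rule L2_set_le_sum) simp
  finally show ?thesis by (simp add: coeff_sum_def)
qed

section \<open>Bounds on coefficients, uniform in the numbers of crossings\<close>

lemma twist_var_mult: "twist_var u * twist_var (\<not> u) = 1"
  by (simp add: twist_var_def var_A_def var_A_inv_def mult_single)

lemma loop_d_twist_var: "loop_d = - (twist_var (\<not> u) ^ 2) - twist_var u ^ 2"
  by (cases u) (simp_all add: loop_d_def twist_var_def)

text \<open>The factor of a curl under the first Reidemeister move: one of the two terms of \<beta>
  d is -\<alpha> and cancels. It matters that a unit remains.\<close>

lemma twisted_eigenvalue: "twist_var u + twist_var (\<not> u) * loop_d = - (twist_var (\<not> u) ^ 3)"
proof -
  let ?a = "twist_var u" and ?b = "twist_var (\<not> u)"
  have "?b * ?a ^ 2 = ?a * (?a * ?b)" by (simp add: power2_eq_square algebra_simps)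
  also have "\<dots> = ?a" by (simp add: twist_var_mult)
  finally show ?thesis
    by (simp add: loop_d_twist_var[of u] algebra_simps power3_eq_cube power2_eq_square)
qed

text \<open>The factors d and \<beta> combine to \<gamma> - \<alpha>, which telescopes the geometric
  sum into a difference of two units.\<close>

lemma loop_d_turned_coeff:
  "loop_d * turned_coeff u n = (- (twist_var (\<not> u) ^ 3)) ^ n - twist_var u ^ n"
proof -
  let ?a = "twist_var u" and ?b = "twist_var (\<not> u)" and ?g = "twist_var u + twist_var (\<not> u) * loop_d"
  have "loop_d * turned_coeff u n = (\<Sum>r<n. (?g - ?a) * (?g ^ (n - Suc r) * ?a ^ r))"
    by (simp add: turned_coeff_def sum_distrib_left algebra_simps)
  also have "\<dots> = ?g ^ n - ?a ^ n"
    unfolding sum_distrib_left[symmetric]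
    using power_diff_sumr2[of ?a n ?g] by (simp add: algebra_simps)
  finally show ?thesis by (simp add: twisted_eigenvalue)
qed

lemma coeff_sum_twist_var [simp]: "coeff_sum (twist_var u) = 1"
  by (simp add: twist_var_def var_A_def var_A_inv_def)

lemma coeff_sum_power_le_1: "coeff_sum f \<le> 1 \<Longrightarrow> coeff_sum (f ^ n) \<le> 1"
  using coeff_sum_power[of f n] power_le_one[of "coeff_sum f" n] coeff_sum_nonneg[of f] by linarith

lemma coeff_sum_loop_d_turned_coeff: "coeff_sum (loop_d * turned_coeff u n) \<le> 2"
proof -
  have "coeff_sum ((- (twist_var (\<not> u) ^ 3)) ^ n) \<le> 1"
    by (intro coeff_sum_power_le_1) (simp add: coeff_sum_power_le_1)
  moreover have "coeff_sum (twist_var u ^ n) \<le> 1" by (simp add: coeff_sum_power_le_1)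
  ultimately show ?thesis
    unfolding loop_d_turned_coeff
    using coeff_sum_add[of "(- (twist_var (\<not> u) ^ 3)) ^ n" "- (twist_var u ^ n)"] by simp
qed

lemma coeff_sum_loop_d: "coeff_sum loop_d \<le> 2"
  using coeff_sum_add[of "- (var_A_inv ^ 2)" "- (var_A ^ 2)"]
    coeff_sum_power_le_1[of var_A 2] coeff_sum_power_le_1[of var_A_inv 2]
  by (simp add: loop_d_def var_A_def var_A_inv_def)

text \<open>Each edge in \<open>T\<close> receives one of the \<open>e\<close> factors d. This
  clears its denominator and leaves a coefficient sum of at most 2, while the other edges carry
  powers of a unit. The \<open>e - card T\<close> factors left over account for
  \<open>2 ^ e\<close>.\<close>

lemma coeff_sum_state_le:
  fixes G t F
  defines "T \<equiv> {i \<in> {..<num_edges G}. (i \<in> F) \<noteq> (color G i = Col_c)}"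
  assumes "card T \<le> e"
  shows "coeff_sum (loop_d ^ e * (\<Prod>i<num_edges G. edge_coeff G t (i \<in> F) i)) \<le> 2 ^ e * 2 ^ num_edges G"
proof -
  let ?c = "\<lambda>i. edge_coeff G t (i \<in> F) i"
  let ?d = "\<lambda>i. if i \<in> T then loop_d else 1"
  have T: "T \<subseteq> {..<num_edges G}" by (auto simp: T_def)
  have "(\<Prod>i<num_edges G. ?d i) = loop_d ^ card T"
    using T by (simp add: prod.If_cases Int_absorb1)
  then have "loop_d ^ e * (\<Prod>i<num_edges G. ?c i)
      = loop_d ^ (e - card T) * (\<Prod>i<num_edges G. ?d i * ?c i)"
    using assms(2) by (simp add: prod.distrib mult.assoc[symmetric] power_add[symmetric])
  moreover have "coeff_sum (loop_d ^ (e - card T)) \<le> 2 ^ e"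
  proof -
    have "coeff_sum (loop_d ^ (e - card T)) \<le> coeff_sum loop_d ^ (e - card T)" by (rule coeff_sum_power)
    also have "\<dots> \<le> 2 ^ (e - card T)" by (rule power_mono[OF coeff_sum_loop_d coeff_sum_nonneg])
    also have "\<dots> \<le> 2 ^ e" by (rule power_increasing) auto
    finally show ?thesis .
  qed
  moreover have "coeff_sum (\<Prod>i<num_edges G. ?d i * ?c i) \<le> 2 ^ num_edges G"
  proof -
    have "coeff_sum (?d i * ?c i) \<le> 2" if "i < num_edges G" for i
    proof (cases "i \<in> T")
      case True
      then have "?c i = turned_coeff ((t i > 0) = (color G i = Col_c)) (nat \<bar>t i\<bar>)"
        unfolding T_def edge_coeff_def Let_def by simp
      then show ?thesis using True coeff_sum_loop_d_turned_coeff by simp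
    next
      case False
      then have "?c i = twist_var ((t i > 0) = (color G i = Col_c)) ^ nat \<bar>t i\<bar>"
        using that unfolding T_def edge_coeff_def Let_def by simp
      then show ?thesis using False coeff_sum_power_le_1[of "twist_var _"] by (simp add: order_trans[of _ 1])
    qed
    then have "(\<Prod>i<num_edges G. coeff_sum (?d i * ?c i)) \<le> (\<Prod>i<num_edges G. 2)"
      by (intro prod_mono) (simp add: coeff_sum_nonneg)
    then show ?thesis using coeff_sum_prod[of "\<lambda>i. ?d i * ?c i" "{..<num_edges G}"] by simp
  qed
  ultimately show ?thesis by (simp add: coeff_sum_mult_le)
qed

lemma (in plane_colored_graph) coeff_sum_bracket_bounded:
  obtains B where "\<And>t. coeff_sum (loop_d ^ max_tree_weight * kauffman_bracket (twisted_diagram G t)) \<le> B"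
proof
  let ?k = "num_edges G"
  fix t
  let ?e = "\<lambda>F. max_tree_weight + (circles G F - 1)"
  have "loop_d ^ max_tree_weight * kauffman_bracket (twisted_diagram G t)
      = (\<Sum>F\<in>Pow {..<?k}. loop_d ^ ?e F * (\<Prod>i<?k. edge_coeff G t (i \<in> F) i))"
    unfolding kauffman_bracket_twisted_diagram sum_distrib_left
    by (simp add: power_add mult_ac)
  then have "coeff_sum (loop_d ^ max_tree_weight * kauffman_bracket (twisted_diagram G t))
      = coeff_sum (\<Sum>F\<in>Pow {..<?k}. loop_d ^ ?e F * (\<Prod>i<?k. edge_coeff G t (i \<in> F) i))"
    by (rule arg_cong)
  also have "\<dots> \<le> (\<Sum>F\<in>Pow {..<?k}. coeff_sum (loop_d ^ ?e F * (\<Prod>i<?k. edge_coeff G t (i \<in> F) i)))"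
    by (rule coeff_sum_sum)
  also have "\<dots> \<le> (\<Sum>F\<in>Pow {..<?k}. 2 ^ ?e F * 2 ^ ?k)"
  proof (rule sum_mono)
    fix F assume "F \<in> Pow {..<?k}"
    then have F: "F \<subseteq> {..<?k}" by simp
    \<comment> \<open>Here the choice of the exponent pays off: together with the factors d from the
      circles it provides one factor for every turned edge.\<close>
    have "card {i \<in> {..<?k}. (i \<in> F) \<noteq> (color G i = Col_c)} \<le> ?e F"
      using tree_weight_le[OF F] circles_pos[of F] unfolding tree_weight_eq[OF F] max_tree_weight_def
      by linarith
    then show "coeff_sum (loop_d ^ ?e F * (\<Prod>i<?k. edge_coeff G t (i \<in> F) i)) \<le> 2 ^ ?e F * 2 ^ ?k"
      by (rule coeff_sum_state_le)
  qed
  finally show "coeff_sum (loop_d ^ max_tree_weight * kauffman_bracket (twisted_diagram G t))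
      \<le> (\<Sum>F\<in>Pow {..<?k}. 2 ^ ?e F * 2 ^ ?k)" .
qed

text \<open>At a primitive sixth root of unity \<open>d = 1\<close> and \<open>A + A\<inverse> = 1\<close>, so every bracket is \<open>1\<close> there.\<close>

lemma kauffman_bracket_neq_0: "kauffman_bracket D \<noteq> 0"
proof -
  define z w where "z = cis (pi / 3)" and "w = cis (- (pi / 3))"
  have z: "z \<noteq> 0" by (simp add: z_def)
  have A: "int_eval z var_A = z" "int_eval z var_A_inv = w"
    by (simp_all add: var_A_def var_A_inv_def z_def w_def cis_inverse power_int_minus)
  have sum: "z + w = 1"
    by (simp add: z_def w_def complex_eq_iff cos_60)
  have prod: "z * w = 1" by (simp add: z_def w_def cis_mult)
  have "z ^ 2 + w ^ 2 = (z + w) ^ 2 - 2 * (z * w)"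
    by (simp add: power2_eq_square algebra_simps)
  also have "\<dots> = -1" unfolding sum prod by simp
  finally have e: "z ^ 2 + w ^ 2 = -1" .
  have "- (w ^ 2) - z ^ 2 = - (z ^ 2 + w ^ 2)" by simp
  then have "- (w ^ 2) - z ^ 2 = 1" unfolding e by simp
  then have d: "int_eval z loop_d = 1"
    using z by (simp add: loop_d_def A)
  have "int_eval z (bracket_rec ps D) = 1" for ps
  proof (induction ps D rule: bracket_rec.induct)
    case (3 ps a b c d D)
    then show ?case using z sum by (simp add: A)
  qed (use z d in simp_all)
  then show ?thesis by (metis int_eval_0 kauffman_bracket_def zero_neq_one)
qed

section \<open>Mahler measure\<close>

text \<open>By concavity the sine lies above its chord from 0 to pi / 2, and the symmetry of
  \<open>x\<close> and \<open>1 - x\<close> covers the other half. A product as lower bound has a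
  logarithm that splits.\<close>

lemma sin_pi_times_ge:
  fixes x :: real
  assumes "0 \<le> x" "x \<le> 1" shows "x * (1 - x) \<le> sin (pi * x)"
proof -
  have conv: "convex_on {0..pi} (\<lambda>x. - sin x)"
    by (rule f''_ge0_imp_convex[where f' = "\<lambda>x. - cos x" and f'' = sin])
      (auto intro!: derivative_eq_intros sin_ge_zero)
  have half: "2 * y \<le> sin (pi * y)" if "0 \<le> y" "y \<le> 1 / 2" for y :: real
    using convex_onD[OF conv, of "2 * y" 0 "pi / 2"] that by (simp add: mult.commute)
  show ?thesis
  proof (cases "x \<le> 1 / 2")
    case True
    have "x * (1 - x) \<le> x * 1" by (rule mult_left_mono) (use assms in auto)
    then show ?thesis using half[of x] assms True by simp
  next
    case False
    have "sin (pi * (1 - x)) = sin (pi * x)" by (simp add: right_diff_distrib)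
    moreover have "x * (1 - x) \<le> 1 * (1 - x)" by (rule mult_right_mono) (use assms in auto)
    ultimately show ?thesis using half[of "1 - x"] assms False by simp
  qed
qed

text \<open>Apply \<open>ln u \<le> u - 1\<close> to \<open>u = 1 / sqrt y\<close>. This gives an
  integrable minorant near a logarithmic singularity.\<close>

lemma ln_ge_minus_inverse_sqrt:
  fixes y :: real
  assumes "y > 0" shows "ln y \<ge> - 2 * (1 / sqrt y)"
proof -
  have "ln (1 / sqrt y) \<le> 1 / sqrt y - 1" by (rule ln_le_minus_one) (use assms in simp)
  moreover have "ln (1 / sqrt y) = - (ln y / 2)" using assms by (simp add: ln_div ln_sqrt)
  ultimately show ?thesis by simp
qed

text \<open>Because the real \<open>sqrt\<close> is an odd function, \<open>2 * sqrt (x - b)\<close>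
  is a continuous antiderivative on both sides of the singularity.\<close>

lemma inverse_sqrt_integrable:
  fixes b :: real
  shows "(\<lambda>x. 1 / sqrt \<bar>x - b\<bar>) integrable_on {0..1}"
proof -
  have "((\<lambda>x. 1 / sqrt \<bar>x - b\<bar>) has_integral (2 * sqrt (1 - b) - 2 * sqrt (0 - b))) {0..1}"
  proof (rule fundamental_theorem_of_calculus_interior_strong[of "{b}"])
    show "((\<lambda>x. 2 * sqrt (x - b)) has_vector_derivative 1 / sqrt \<bar>x - b\<bar>) (at x)"
      if "x \<in> {0<..<1} - {b}" for x
    proof -
      have "x - b \<noteq> 0" using that by simp
      then have "(sqrt has_real_derivative 1 / (2 * sqrt \<bar>x - b\<bar>)) (at (x - b))"
        by (rule DERIV_real_sqrt_generic) 
          (use real_sqrt_minus[of "x - b"] in \<open>simp_all add: divide_simps\<close>)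
      moreover have "((\<lambda>x. x - b) has_real_derivative 1) (at x)"
        by (auto intro!: derivative_eq_intros)
      ultimately have "((\<lambda>x. sqrt (x - b)) has_real_derivative 1 / (2 * sqrt \<bar>x - b\<bar>) * 1) (at x)"
        by (rule DERIV_chain2)
      from DERIV_cmult[OF this, of 2] have "((\<lambda>x. 2 * sqrt (x - b)) has_real_derivative 1 / sqrt \<bar>x - b\<bar>) (at x)" by simp
      then show ?thesis by (simp add: has_real_derivative_iff_has_vector_derivative)
    qed
  qed (auto intro!: continuous_intros)
  then show ?thesis by blast
qed

section \<open>Logarithms of polynomials on the unit circle\<close>

definition circle_point :: "real \<Rightarrow> complex" where
  "circle_point \<theta> = exp (2 * of_real pi * \<i> * of_real \<theta>)"

lemma norm_circle_point [simp]: "cmod (circle_point \<theta>) = 1"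
  by (simp add: circle_point_def)

lemma circle_point_neq_0 [simp]: "circle_point \<theta> \<noteq> 0"
  by (simp add: circle_point_def)

lemma continuous_on_circle_point [continuous_intros]: "continuous_on A circle_point"
  unfolding circle_point_def[abs_def] by (intro continuous_intros)

lemma circle_point_add: "circle_point (a + b) = circle_point a * circle_point b"
  by (simp add: circle_point_def algebra_simps exp_add)

lemma circle_point_power: "circle_point \<theta> ^ n = circle_point (n * \<theta>)"
  by (simp add: circle_point_def exp_of_nat_mult[symmetric] algebra_simps)

lemma circle_point_1 [simp]: "circle_point 1 = 1"
  by (simp add: circle_point_def)

lemma circle_point_eq_cis: "circle_point \<theta> = cis (2 * pi * \<theta>)"
  by (simp add: circle_point_def cis_conv_exp algebra_simps)

lemma unit_circle_circle_point:
  assumes "cmod a = 1" obtains \<alpha> where "0 \<le> \<alpha>" "\<alpha> \<le> 1" "a = circle_point \<alpha>"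
proof -
  have "a = cis (Arg2pi a)" using Arg2pi_eq[of a] assms by (simp add: cis_conv_exp)
  then show thesis
    using Arg2pi_ge_0[of a] Arg2pi_lt_2pi[of a]
    by (intro that[of "Arg2pi a / (2 * pi)"]) (simp_all add: circle_point_eq_cis)
qed

lemma dist_circle_point: "cmod (circle_point x - circle_point y) = 2 * \<bar>sin (pi * (x - y))\<bar>"
proof -
  have "circle_point x - circle_point y = circle_point y * (exp (\<i> * of_real (2 * pi * (x - y))) - 1)"
    unfolding right_diff_distrib by (simp add: circle_point_def exp_add[symmetric] algebra_simps)
  then have "cmod (circle_point x - circle_point y) = cmod (exp (\<i> * of_real (2 * pi * (x - y))) - 1)"
    by (simp only: norm_mult norm_circle_point mult_1)
  then show ?thesis unfolding dist_exp_i_1 by simp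
qed

lemma measurable_ln_cmod:
  assumes "continuous_on UNIV f"
  shows "(\<lambda>\<theta>::real. ln (cmod (f \<theta>))) \<in> borel_measurable (lebesgue_on A)"
proof -
  have "(\<lambda>\<theta>. cmod (f \<theta>)) \<in> borel_measurable borel"
    by (intro borel_measurable_continuous_onI continuous_intros assms)
  then have "(\<lambda>\<theta>. ln (cmod (f \<theta>))) \<in> borel_measurable borel" by measurable
  then show ?thesis by (intro measurable_restrict_space1 measurable_completion) simp
qed

lemma integrable_ln_dist_circle_point:
  shows "(\<lambda>\<theta>. ln (cmod (circle_point \<theta> - a))) integrable_on {0..1}"
proof (cases "cmod a = 1")
  case False
  have "circle_point \<theta> \<noteq> a" for \<theta> using False norm_circle_point by metis
  then show ?thesis by (intro integrable_continuous_interval continuous_intros) auto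
next
  case True
  then obtain \<alpha> where \<alpha>: "0 \<le> \<alpha>" "\<alpha> \<le> 1" "a = circle_point \<alpha>" by (rule unit_circle_circle_point)
  let ?s = "\<lambda>b \<theta>. 1 / sqrt \<bar>\<theta> - b\<bar> :: real"
  have arith: "\<bar>w\<bar> \<le> e + 2 * (s + s' + s'')"
    if "p = a + b + c" "p \<le> w" "- 2 * A \<le> a" "- 2 * B \<le> b" "- 2 * C \<le> c"
      "A + B + C = s + s' + s''" "w \<le> e" "0 < e" "0 \<le> s" "0 \<le> s'" "0 \<le> s''"
    for p a b c w A B C s s' s'' e :: real
  proof -
    have "w \<le> e + 2 * (s + s' + s'')" using that(7-11) by argo
    moreover have "- w \<le> 2 * (A + B + C)" using that(1-5) by argo
    ultimately show ?thesis using that(6,8) by (simp add: abs_le_iff)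
  qed
  have bound: "\<bar>ln (cmod (circle_point \<theta> - a))\<bar>
      \<le> ln 2 + 2 * (?s \<alpha> \<theta> + ?s (1 + \<alpha>) \<theta> + ?s (\<alpha> - 1) \<theta>)" if \<theta>: "\<theta> \<in> {0..1}" for \<theta>
  proof (cases "circle_point \<theta> = a")
    case True
    \<comment> \<open>The left-hand side is \<open>ln 0\<close>, which is 0.\<close>
    then show ?thesis by simp
  next
    case False
    define x where "x = \<bar>\<theta> - \<alpha>\<bar>"
    have x: "0 \<le> x" "x \<le> 1" using \<alpha> \<theta> by (auto simp: x_def)
    have dist: "cmod (circle_point \<theta> - a) = 2 * \<bar>sin (pi * x)\<bar>"
    proof -
      have "pi * (\<theta> - \<alpha>) = pi * x \<or> pi * (\<theta> - \<alpha>) = - (pi * x)" by (auto simp: x_def abs_if algebra_simps)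
      then show ?thesis unfolding \<alpha>(3) dist_circle_point by (elim disjE) simp_all
    qed
    then have "sin (pi * x) \<noteq> 0" using False by auto
    then have x': "0 < x" "x < 1" using x by (auto simp: less_le)
    \<comment> \<open>The factor \<open>1 + x\<close>, at most 2, is there for symmetry: up to
      order, \<open>x\<close>, \<open>1 - x\<close> and \<open>1 + x\<close> are the distances of
      \<theta> from \<alpha>, \<open>1 + \<alpha>\<close> and \<open>\<alpha> - 1\<close> on either
      side of \<alpha>, so a single majorant serves for both.\<close>
    have "x * (1 - x) * (1 + x) \<le> sin (pi * x) * 2"
      by (intro mult_mono sin_pi_times_ge) (use x sin_ge_zero[of "pi * x"] in auto)
    then have low: "x * (1 - x) * (1 + x) \<le> cmod (circle_point \<theta> - a)" unfolding dist by linarith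
    have pos: "0 < x * (1 - x) * (1 + x)" using x' by simp
    have "ln (x * (1 - x) * (1 + x)) = ln x + ln (1 - x) + ln (1 + x)"
      using x' by (simp add: ln_mult)
    moreover have "ln (x * (1 - x) * (1 + x)) \<le> ln (cmod (circle_point \<theta> - a))"
      using low pos by (intro ln_mono) auto
    moreover have "ln x \<ge> - 2 * (1 / sqrt x)" "ln (1 - x) \<ge> - 2 * (1 / sqrt (1 - x))"
      "ln (1 + x) \<ge> - 2 * (1 / sqrt (1 + x))"
      by (intro ln_ge_minus_inverse_sqrt; use x' in simp)+
    moreover have "1 / sqrt x + 1 / sqrt (1 - x) + 1 / sqrt (1 + x)
        = ?s \<alpha> \<theta> + ?s (1 + \<alpha>) \<theta> + ?s (\<alpha> - 1) \<theta>"
      using \<alpha> \<theta> x' by (cases "\<theta> \<le> \<alpha>") (auto simp: x_def abs_if algebra_simps)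
    moreover have "ln (cmod (circle_point \<theta> - a)) \<le> ln 2"
    proof (rule ln_mono)
      show "cmod (circle_point \<theta> - a) \<le> 2" unfolding dist using abs_sin_le_one[of "pi * x"] by linarith
    qed (use False in auto)
    moreover have "ln 2 > (0::real)" by simp
    moreover have "?s \<alpha> \<theta> \<ge> 0" "?s (1 + \<alpha>) \<theta> \<ge> 0" "?s (\<alpha> - 1) \<theta> \<ge> 0" by auto
    ultimately show ?thesis by (rule arith)
  qed
  show ?thesis
  proof (rule measurable_bounded_by_integrable_imp_integrable_real[OF _ _ bound])
    show "(\<lambda>\<theta>. ln (cmod (circle_point \<theta> - a))) \<in> borel_measurable (lebesgue_on {0..1})"
      by (rule measurable_ln_cmod) (intro continuous_intros)
    have "(\<lambda>\<theta>. ?s \<alpha> \<theta> + ?s (1 + \<alpha>) \<theta> + ?s (\<alpha> - 1) \<theta>) integrable_on {0..1}"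
      by (intro integrable_add inverse_sqrt_integrable)
    then show "(\<lambda>\<theta>. ln 2 + 2 * (?s \<alpha> \<theta> + ?s (1 + \<alpha>) \<theta> + ?s (\<alpha> - 1) \<theta>)) integrable_on {0..1}"
      by (rule integrable_add[OF integrable_const_ivl integrable_on_mult_right])
    show "{0..1::real} \<in> sets lebesgue" by simp
  qed
qed

lemma finite_circle_point_vimage:
  assumes "finite Z" shows "finite {\<theta> \<in> {0..1}. circle_point \<theta> \<in> Z}"
proof -
  have "inj_on circle_point {0..<1}"
  proof (rule inj_onI)
    fix x y :: real assume xy: "x \<in> {0..<1}" "y \<in> {0..<1}" "circle_point x = circle_point y"
    then obtain n :: int where "2 * of_real pi * \<i> * of_real x = 2 * of_real pi * \<i> * of_real y + of_int (2 * n) * of_real pi * \<i>"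
      unfolding circle_point_def exp_eq by auto
    then have "2 * pi * x = 2 * pi * y + 2 * n * pi"
      by (simp add: complex_eq_iff)
    then have "2 * pi * (x - y - n) = 0" by (simp add: algebra_simps)
    then have n: "x - y = n" by simp
    then have "\<bar>real_of_int n\<bar> < 1" using xy by auto
    then have "n = 0" by linarith
    then show "x = y" using n by simp
  qed
  then have "finite (circle_point -` Z \<inter> {0..<1})" by (rule finite_vimage_IntI[OF assms])
  then have "finite (insert 1 (circle_point -` Z \<inter> {0..<1}))" by simp
  moreover have "{\<theta> \<in> {0..1}. circle_point \<theta> \<in> Z} \<subseteq> insert 1 (circle_point -` Z \<inter> {0..<1})" by auto
  ultimately show ?thesis by (rule finite_subset[rotated])
qed

text \<open>Roots are split off one at a time. The logarithm of the product can differ from the sum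
  of the logarithms only at roots, where \<open>ln 0 = 0\<close>, and finitely many points do not
  affect the integral.\<close>

lemma integrable_ln_poly_circle_point:
  assumes "P \<noteq> 0"
  shows "(\<lambda>\<theta>. ln (cmod (poly P (circle_point \<theta>)))) integrable_on {0..1}"
  using assms
proof (induction "degree P" arbitrary: P)
  case 0
  then obtain c where "P = [:c:]" by (metis degree_eq_zeroE)
  then show ?case by (simp add: integrable_const_ivl)
next
  case (Suc n)
  then have "\<not> constant (poly P)" by (simp add: constant_degree)
  then obtain a where "poly P a = 0" using fundamental_theorem_of_algebra by blast
  then obtain Q where Q: "P = [:- a, 1:] * Q" by (metis dvdE poly_eq_0_iff_dvd)
  then have "Q \<noteq> 0" using Suc.prems by auto
  then have "degree P = 1 + degree Q" unfolding Q by (subst degree_mult_eq) auto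
  then have "(\<lambda>\<theta>. ln (cmod (poly Q (circle_point \<theta>)))) integrable_on {0..1}"
    using Suc.hyps \<open>Q \<noteq> 0\<close> by simp
  then have int: "(\<lambda>\<theta>. ln (cmod (circle_point \<theta> - a)) + ln (cmod (poly Q (circle_point \<theta>)))) integrable_on {0..1}"
    by (intro integrable_add integrable_ln_dist_circle_point)
  have P: "poly P z = (z - a) * poly Q z" for z by (simp add: Q algebra_simps)
  show ?case
  proof (rule integrable_spike_finite[OF _ _ int])
    show "finite {\<theta> \<in> {0..1}. circle_point \<theta> \<in> {z. poly P z = 0}}"
      by (intro finite_circle_point_vimage poly_roots_finite Suc.prems)
    fix \<theta> :: real assume "\<theta> \<in> {0..1} - {\<theta> \<in> {0..1}. circle_point \<theta> \<in> {z. poly P z = 0}}"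
    then have "cmod (circle_point \<theta> - a) > 0" "cmod (poly Q (circle_point \<theta>)) > 0" by (auto simp: P)
    then show "ln (cmod (poly P (circle_point \<theta>))) = ln (cmod (circle_point \<theta> - a)) + ln (cmod (poly Q (circle_point \<theta>)))"
      by (simp add: P norm_mult ln_mult)
  qed
qed

text \<open>Dividing by the power of \<open>z\<close> with the lowest exponent keeps the modulus on
  the circle, and the lowest coefficient of \<open>f\<close> becomes a nonzero constant
  term.\<close>

lemma laurent_as_poly:
  assumes "f \<noteq> 0"
  obtains P :: "complex poly" where "P \<noteq> 0" "\<And>z. cmod z = 1 \<Longrightarrow> cmod (int_eval z f) = cmod (poly P z)"
proof -
  let ?K = "Poly_Mapping.keys f" and ?c = "Poly_Mapping.lookup f"
  define m where "m = Min ?K"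
  have K: "finite ?K" "?K \<noteq> {}" using assms by auto
  have m: "m \<in> ?K" "\<And>n. n \<in> ?K \<Longrightarrow> m \<le> n" using K by (auto simp: m_def)
  define P :: "complex poly" where "P = (\<Sum>n\<in>?K. monom (of_int (?c n)) (nat (n - m)))"
  have "coeff P 0 = (\<Sum>n\<in>?K. if n = m then of_int (?c n) else 0)"
    unfolding P_def coeff_sum
  proof (rule sum.cong[OF refl])
    fix n assume "n \<in> ?K"
    then show "coeff (monom (of_int (?c n)) (nat (n - m))) 0 = (if n = m then of_int (?c n) else 0)"
      using m(2)[of n] by auto
  qed
  also have "\<dots> = of_int (?c m)" using m(1) by simp
  finally have "coeff P 0 \<noteq> 0" using m(1) by (simp add: in_keys_iff)
  then have "P \<noteq> 0" by auto
  moreover have "cmod (int_eval z f) = cmod (poly P z)" if "cmod z = 1" for z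
  proof -
    have z: "z \<noteq> 0" using that by auto
    have "int_eval z f = z powi m * poly P z"
      unfolding int_eval_def P_def poly_sum sum_distrib_left poly_monom
    proof (rule sum.cong[OF refl])
      fix n assume "n \<in> ?K"
      then have "z powi m * z ^ nat (n - m) = z powi n"
        using m(2) z by (simp add: power_int_def[symmetric] flip: power_int_of_nat power_int_add)
      then show "of_int (?c n) * z powi n = z powi m * (of_int (?c n) * z ^ nat (n - m))"
        by (simp add: algebra_simps)
    qed
    then show ?thesis using that by (simp add: norm_mult norm_power_int)
  qed
  ultimately show thesis by (rule that)
qed

section \<open>Multiplicativity, and the Mahler measure of d\<close>

definition log_abs :: "int laurent \<Rightarrow> real \<Rightarrow> real" where
  "log_abs f \<theta> = ln (cmod (int_eval (circle_point \<theta>) f))"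

lemma mahler_measure_eq:
  "f \<noteq> 0 \<Longrightarrow> mahler_measure (complex_laurent f) = exp (integral {0..1} (log_abs f))"
  by (simp add: mahler_measure_def laurent_eval_complex_laurent log_abs_def[abs_def] circle_point_def)

lemma log_abs_integrable: "f \<noteq> 0 \<Longrightarrow> log_abs f integrable_on {0..1}"
  unfolding log_abs_def[abs_def]
  by (erule laurent_as_poly) (simp add: integrable_ln_poly_circle_point)

lemma finite_zeros_circle_point:
  assumes "f \<noteq> 0" shows "finite {\<theta> \<in> {0..1}. int_eval (circle_point \<theta>) f = 0}"
proof -
  obtain P :: "complex poly" where P: "P \<noteq> 0" "\<And>z. cmod z = 1 \<Longrightarrow> cmod (int_eval z f) = cmod (poly P z)"
    using laurent_as_poly[OF assms] by blast
  have "int_eval (circle_point \<theta>) f = 0 \<longleftrightarrow> circle_point \<theta> \<in> {z. poly P z = 0}" for \<theta>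
    using P(2)[of "circle_point \<theta>"] by (metis mem_Collect_eq norm_circle_point norm_eq_zero)
  then show ?thesis using finite_circle_point_vimage[OF poly_roots_finite[OF P(1)]] by simp
qed

lemma log_abs_mult_integral:
  assumes "f \<noteq> 0" "g \<noteq> 0"
  shows "(log_abs (f * g) has_integral (integral {0..1} (log_abs f) + integral {0..1} (log_abs g))) {0..1}"
proof (rule has_integral_spike_finite)
  show "finite {\<theta> \<in> {0..1}. int_eval (circle_point \<theta>) (f * g) = 0}"
    using assms by (intro finite_zeros_circle_point) simp
  show "log_abs (f * g) x = log_abs f x + log_abs g x"
    if "x \<in> {0..1} - {\<theta> \<in> {0..1}. int_eval (circle_point \<theta>) (f * g) = 0}" for x
    using that by (auto simp: log_abs_def norm_mult ln_mult)
  show "((\<lambda>x. log_abs f x + log_abs g x) has_integral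
      (integral {0..1} (log_abs f) + integral {0..1} (log_abs g))) {0..1}"
    using assms by (intro has_integral_add integrable_integral log_abs_integrable)
qed

lemma mahler_measure_mult:
  "mahler_measure (complex_laurent (f * g))
    = mahler_measure (complex_laurent f) * mahler_measure (complex_laurent g)"
proof (cases "f = 0 \<or> g = 0")
  case True
  then show ?thesis by (auto simp: mahler_measure_def)
next
  case False
  then show ?thesis
    using integral_unique[OF log_abs_mult_integral[of f g]] by (simp add: mahler_measure_eq exp_add)
qed

text \<open>Doubling the argument runs through two periods at twice the speed.\<close>

lemma has_integral_double:
  fixes g :: "real \<Rightarrow> real"
  assumes int: "(g has_integral I) {0..1}" and per: "\<And>x. g (x + 1) = g x"
  shows "((\<lambda>x. g (2 * x)) has_integral I) {0..1}"
proof -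
  have "((\<lambda>x. g (x + - 1)) has_integral I) {0 - - 1..1 - - 1}"
    by (rule has_integral_shift_real_ivl[OF int])
  moreover have "(\<lambda>x. g (x + - 1)) = g" using per[of "_ - 1"] by auto
  ultimately have "(g has_integral I) {1..2}" by simp
  with int have "(g has_integral (I + I)) {0..2}" by (intro has_integral_combine[of 0 1 2]) auto
  from has_integral_stretch_real[OF this, of 2]
  have "((\<lambda>x. g (2 * x)) has_integral I) ((\<lambda>x. x / 2) ` {0..2})" by simp
  moreover have "(\<lambda>x::real. x / 2) ` {0..2} = {0..1}"
    using image_divide_atLeastAtMost[of 2 0 2] by simp
  ultimately show ?thesis by simp
qed

text \<open>On the unit circle \<open>|d| = |1 + A\<^sup>4|\<close> is the quotient of \<open>|1 - A\<^sup>8|\<close> by \<open>|1 - A\<^sup>4|\<close>,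
  and these two have the same mean logarithm because the first is the second after doubling the angle.\<close>

lemma mahler_measure_loop_d: "mahler_measure (complex_laurent loop_d) = 1"
proof -
  define f g :: "int laurent" where "f = 1 - var_A ^ 4" and "g = 1 - var_A ^ 8"
  have A: "int_eval (circle_point \<theta>) var_A = circle_point \<theta>" for \<theta> by (simp add: var_A_def)
  have "int_eval (circle_point (1 / 8)) f = 2"
  proof -
    have "circle_point (1 / 8) ^ 4 = -1" by (simp add: circle_point_power) (simp add: circle_point_eq_cis)
    then show ?thesis by (simp add: f_def A)
  qed
  then have f: "f \<noteq> 0" by auto
  have "int_eval (circle_point 0) loop_d = -2"
    by (simp add: loop_d_def var_A_def var_A_inv_def circle_point_def)
  then have d: "loop_d \<noteq> 0" by auto
  have inv: "var_A * var_A_inv = 1" by (simp add: var_A_def var_A_inv_def mult_single)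
  have "var_A ^ 2 * loop_d = - ((var_A * var_A_inv) ^ 2) - var_A ^ 4"
    by (simp add: loop_d_def power_mult_distrib right_diff_distrib power_add[symmetric])
  then have s: "var_A ^ 2 * loop_d = - 1 - var_A ^ 4" by (simp add: inv)
  have "f * (loop_d * (- (var_A ^ 2))) = - (f * (var_A ^ 2 * loop_d))" by (simp add: algebra_simps)
  also have "\<dots> = g" unfolding s by (simp add: f_def g_def algebra_simps power_add[symmetric])
  finally have g: "g = f * (loop_d * (- (var_A ^ 2)))" ..
  have u: "- (var_A ^ 2) \<noteq> (0 :: int laurent)"
    using inv by (metis mult_zero_left neg_equal_0_iff_equal power_eq_0_iff zero_neq_one)
  have "log_abs (- (var_A ^ 2)) = (\<lambda>_. 0)"
    by (rule ext) (simp add: log_abs_def A norm_power)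
  then have u0: "integral {0..1} (log_abs (- (var_A ^ 2))) = 0" by simp
  have "integral {0..1} (log_abs g)
      = integral {0..1} (log_abs f) + (integral {0..1} (log_abs loop_d) + 0)"
    unfolding g integral_unique[OF log_abs_mult_integral[OF f no_zero_divisors[OF d u]]]
      integral_unique[OF log_abs_mult_integral[OF d u]] u0 ..
  moreover have "integral {0..1} (log_abs g) = integral {0..1} (log_abs f)"
  proof -
    have "log_abs f (x + 1) = log_abs f x" for x
      by (simp add: log_abs_def circle_point_add)
    then have "((\<lambda>x. log_abs f (2 * x)) has_integral integral {0..1} (log_abs f)) {0..1}"
      by (intro has_integral_double integrable_integral log_abs_integrable f)
    moreover have "log_abs f (2 * x) = log_abs g x" for x
      by (simp add: log_abs_def f_def g_def A circle_point_power algebra_simps)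
    ultimately show ?thesis by (simp add: integral_unique)
  qed
  ultimately show ?thesis using d by (simp add: mahler_measure_eq)
qed

lemma mahler_measure_loop_d_power_mult:
  "mahler_measure (complex_laurent (loop_d ^ p * f)) = mahler_measure (complex_laurent f)"
  by (induction p) (simp_all add: mahler_measure_mult mahler_measure_loop_d mult.assoc)

section \<open>Parseval's identity and the strict inequality\<close>

lemma has_integral_cos_int:
  "((\<lambda>x. cos (2 * pi * of_int n * x)) has_integral (if n = 0 then 1 else 0)) {0..1}"
proof (cases "n = 0")
  case True
  then show ?thesis using has_integral_const_real[of "1::real" 0 1] by simp
next
  case False
  let ?c = "2 * pi * of_int n"
  have "((\<lambda>x. cos (?c * x)) has_integral (sin (?c * 1) / ?c - sin (?c * 0) / ?c)) {0..1}"
  proof (rule fundamental_theorem_of_calculus)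
    fix x :: real
    have "((\<lambda>x. sin (?c * x) / ?c) has_real_derivative cos (?c * x)) (at x within {0..1})"
      using False by (auto intro!: derivative_eq_intros)
    then show "((\<lambda>x. sin (?c * x) / ?c) has_vector_derivative cos (?c * x)) (at x within {0..1})"
      by (simp add: has_real_derivative_iff_has_vector_derivative)
  qed simp
  moreover have "sin ?c = 0" using sin_int_2pin[of n] by (simp add: mult.assoc)
  ultimately show ?thesis using False by simp
qed

lemma circle_point_powi: "circle_point \<theta> powi n = circle_point (of_int n * \<theta>)"
proof -
  have "exp (of_int n * (2 * of_real pi * \<i> * of_real \<theta>)) = circle_point \<theta> powi n"
    unfolding circle_point_def by (rule exp_power_int[symmetric])
  then show ?thesis by (simp add: circle_point_def algebra_simps)
qed

text \<open>As the coefficients are real, the squared modulus is a double sum of cosines with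
  frequencies \<open>n - m\<close>, and only the diagonal survives integration.\<close>

lemma parseval:
  "((\<lambda>\<theta>. (cmod (int_eval (circle_point \<theta>) f))\<^sup>2) has_integral (l2_norm (complex_laurent f))\<^sup>2) {0..1}"
proof -
  let ?K = "Poly_Mapping.keys f" and ?c = "\<lambda>n. real_of_int (Poly_Mapping.lookup f n)"
  let ?a = "\<lambda>n \<theta>. 2 * pi * (of_int n * \<theta>)"
  have eq: "(cmod (int_eval (circle_point \<theta>) f))\<^sup>2
      = (\<Sum>n\<in>?K. \<Sum>m\<in>?K. ?c n * ?c m * cos (2 * pi * of_int (n - m) * \<theta>))" for \<theta>
  proof -
    have "int_eval (circle_point \<theta>) f = (\<Sum>n\<in>?K. of_real (?c n) * cis (?a n \<theta>))"
      unfolding int_eval_def circle_point_powi by (simp add: circle_point_eq_cis)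
    then have re_im: "Re (int_eval (circle_point \<theta>) f) = (\<Sum>n\<in>?K. ?c n * cos (?a n \<theta>))"
      "Im (int_eval (circle_point \<theta>) f) = (\<Sum>n\<in>?K. ?c n * sin (?a n \<theta>))"
      by simp_all
    have "(cmod (int_eval (circle_point \<theta>) f))\<^sup>2
        = (\<Sum>n\<in>?K. \<Sum>m\<in>?K. ?c n * cos (?a n \<theta>) * (?c m * cos (?a m \<theta>)))
        + (\<Sum>n\<in>?K. \<Sum>m\<in>?K. ?c n * sin (?a n \<theta>) * (?c m * sin (?a m \<theta>)))"
      unfolding cmod_power2 re_im by (simp only: power2_eq_square sum_product)
    also have "\<dots> = (\<Sum>n\<in>?K. \<Sum>m\<in>?K. ?c n * ?c m * cos (?a n \<theta> - ?a m \<theta>))"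
      unfolding sum.distrib[symmetric] cos_diff by (simp add: algebra_simps)
    also have "\<dots> = (\<Sum>n\<in>?K. \<Sum>m\<in>?K. ?c n * ?c m * cos (2 * pi * of_int (n - m) * \<theta>))"
      by (intro sum.cong refl arg_cong2[where f = "(*)"] arg_cong[where f = cos]) (simp add: algebra_simps)
    finally show ?thesis .
  qed
  have "((\<lambda>\<theta>. \<Sum>n\<in>?K. \<Sum>m\<in>?K. ?c n * ?c m * cos (2 * pi * of_int (n - m) * \<theta>))
      has_integral (\<Sum>n\<in>?K. \<Sum>m\<in>?K. ?c n * ?c m * (if n - m = 0 then 1 else 0))) {0..1}"
    by (intro has_integral_sum has_integral_mult_right has_integral_cos_int finite_keys)
  also have "(\<Sum>n\<in>?K. \<Sum>m\<in>?K. ?c n * ?c m * (if n - m = 0 then 1 else 0)) = (\<Sum>n\<in>?K. (?c n)\<^sup>2)"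
    by (intro sum.cong refl) (simp add: if_distrib power2_eq_square cong: if_cong)
  also have "\<dots> = (l2_norm (complex_laurent f))\<^sup>2"
    by (simp add: l2_norm_def lookup_complex_laurent sum_nonneg)
  finally show ?thesis unfolding eq .
qed

lemma continuous_on_int_eval_circle_point: "continuous_on A (\<lambda>\<theta>. int_eval (circle_point \<theta>) f)"
  unfolding int_eval_def by (intro continuous_intros) auto

text \<open>Jensen's inequality, through \<open>ln y \<le> y - 1\<close> for \<open>y = |f| / N\<close> with \<open>N\<close> the norm; the mean of
  \<open>|f| / N\<close> is less than \<open>1\<close> since \<open>(|f| / N - 1)\<^sup>2\<close> is continuous and not identically \<open>0\<close>.\<close>

lemma mahler_measure_less_l2_norm:
  assumes "f \<noteq> 0" "\<theta>\<^sub>0 \<in> {0..1}" "int_eval (circle_point \<theta>\<^sub>0) f = 0"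
  shows "mahler_measure (complex_laurent f) < l2_norm (complex_laurent f)"
proof -
  define N where "N = l2_norm (complex_laurent f)"
  let ?F = "\<lambda>\<theta>. cmod (int_eval (circle_point \<theta>) f)"
  have "N > 0"
  proof -
    have "(\<Sum>n\<in>Poly_Mapping.keys f. (cmod (Poly_Mapping.lookup (complex_laurent f) n))\<^sup>2) > 0"
      using assms(1) by (intro sum_pos) (auto simp: lookup_complex_laurent in_keys_iff)
    then show ?thesis by (simp add: N_def l2_norm_def)
  qed
  have contF: "continuous_on {0..1} ?F"
    by (intro continuous_intros continuous_on_int_eval_circle_point)
  then have intF: "?F integrable_on {0..1}" by (rule integrable_continuous_interval)
  define m where "m = integral {0..1} ?F"
  have F: "(?F has_integral m) {0..1}" unfolding m_def using intF by (rule integrable_integral)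
  have one: "((\<lambda>_::real. 1::real) has_integral 1) {0..1}" using has_integral_const_real[of "1::real" 0 1] by simp
  let ?q = "\<lambda>\<theta>. (?F \<theta> / N - 1)\<^sup>2"
  have "((\<lambda>\<theta>. (?F \<theta>)\<^sup>2 / N\<^sup>2 - 2 * (?F \<theta> / N) + 1) has_integral (N\<^sup>2 / N\<^sup>2 - 2 * (m / N) + 1)) {0..1}"
    using parseval[of f] F one unfolding N_def[symmetric]
    by (intro has_integral_add has_integral_diff has_integral_divide has_integral_mult_right)
  moreover have "(\<lambda>\<theta>. (?F \<theta>)\<^sup>2 / N\<^sup>2 - 2 * (?F \<theta> / N) + 1) = ?q"
    by (rule ext) (simp add: power2_eq_square algebra_simps)
  ultimately have q: "(?q has_integral (2 - 2 * (m / N))) {0..1}" using \<open>N > 0\<close> by simp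
  have "2 - 2 * (m / N) \<noteq> 0"
  proof
    assume "2 - 2 * (m / N) = 0"
    with q have "integral {0..1} ?q = 0" by (simp add: integral_unique)
    moreover have "continuous_on {0..1} ?q"
      using \<open>N > 0\<close> by (intro continuous_intros continuous_on_int_eval_circle_point) auto
    \<comment> \<open>At the zero \<open>\<theta>\<^sub>0\<close> of f this square is (0 - 1)^2 = 1,
      so the continuous function cannot have integral 0.\<close>
    ultimately have "?q \<theta>\<^sub>0 = 0"
      using integral_eq_0_iff[of 0 1 ?q] assms(2) by auto
    then show False using assms(3) by simp
  qed
  moreover have "2 - 2 * (m / N) \<ge> 0"
    using q by (rule has_integral_nonneg) simp
  ultimately have m: "m / N < 1" by linarith
  have upper: "((\<lambda>\<theta>. ?F \<theta> / N - 1 + ln N) has_integral (m / N - 1 + ln N)) {0..1}"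
    using has_integral_add[OF has_integral_diff[OF has_integral_divide[OF F] one] has_integral_const_real[of "ln N" 0 1]]
    by simp
  \<comment> \<open>At a zero, \<open>log_abs f\<close> is \<open>ln 0 = 0\<close>, which need not
    lie below \<open>ln N - 1\<close>. The finitely many zeros are therefore given the value of the
    upper function.\<close>
  have lower: "((\<lambda>\<theta>. if ?F \<theta> = 0 then ?F \<theta> / N - 1 + ln N else log_abs f \<theta>)
      has_integral integral {0..1} (log_abs f)) {0..1}"
  proof (rule has_integral_spike_finite[OF finite_zeros_circle_point[OF assms(1)]])
    show "(log_abs f has_integral integral {0..1} (log_abs f)) {0..1}"
      by (rule integrable_integral[OF log_abs_integrable[OF assms(1)]])
  qed auto
  have le: "(if ?F \<theta> = 0 then ?F \<theta> / N - 1 + ln N else log_abs f \<theta>) \<le> ?F \<theta> / N - 1 + ln N" for \<theta>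
  proof (cases "?F \<theta> = 0")
    case False
    then have "?F \<theta> > 0" by simp
    then have "ln (?F \<theta> / N) \<le> ?F \<theta> / N - 1" using \<open>N > 0\<close> by (intro ln_le_minus_one) simp
    then show ?thesis using False \<open>?F \<theta> > 0\<close> \<open>N > 0\<close> by (simp add: log_abs_def ln_div)
  qed simp
  have "integral {0..1} (log_abs f) \<le> m / N - 1 + ln N"
    by (rule has_integral_le[OF lower upper]) (rule le)
  then have "integral {0..1} (log_abs f) < ln N" using m by linarith
  then have "exp (integral {0..1} (log_abs f)) < exp (ln N)" by (simp only: exp_less_cancel_iff)
  also have "exp (ln N) = N" using \<open>N > 0\<close> by simp
  finally show ?thesis using assms(1) by (simp add: mahler_measure_eq N_def)
qed

lemma loop_d_zero: "int_eval (circle_point (1 / 8)) loop_d = 0"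
proof -
  have "circle_point (1 / 8) ^ 2 = \<i>"
    unfolding circle_point_power by (simp add: circle_point_eq_cis)
  moreover have "(circle_point (1 / 8) powi (-1)) ^ 2 = inverse (circle_point (1 / 8) ^ 2)"
    by (simp add: power_int_minus power_inverse)
  ultimately show ?thesis by (simp add: loop_d_def var_A_def var_A_inv_def power_int_minus power_inverse)
qed

lemma link_diagram_if_in_links: "L \<in> links \<Longrightarrow> D \<in> L \<Longrightarrow> link_diagram D"
  by (auto simp: links_def same_link_def quotient_def)

theorem corollary2:
  fixes L :: "nat diagram set" and D :: "nat diagram"
    and out :: "nat \<times> nat" and S :: "(nat \<times> nat) set"
    and G :: colored_graph and p :: nat
  assumes "L \<in> links" and "D \<in> L"
    and "arc_free D" and "connected_map (diagram_map D)"
    and "reduced_diagram D" and "twist_classes_by_bigons D"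
    and "twist_number D = link_twist_number L"
    and "checkerboard D out S" and "colored_graph_of D S G" and "num_edges G \<ge> 1"
    and "p = Max {tree_weight G F | F. spanning_tree G F}"
  shows "\<exists>C>0.
    (\<forall>t :: nat \<Rightarrow> int.
       l2_norm (complex_laurent (loop_d ^ p * kauffman_bracket (twisted_diagram G t))) < C) \<and>
    (\<forall>t :: nat \<Rightarrow> int.
       mahler_measure (complex_laurent (kauffman_bracket (twisted_diagram G t)))
         = mahler_measure (complex_laurent (loop_d ^ p * kauffman_bracket (twisted_diagram G t))) \<and>
       mahler_measure (complex_laurent (loop_d ^ p * kauffman_bracket (twisted_diagram G t)))
         < l2_norm (complex_laurent (loop_d ^ p * kauffman_bracket (twisted_diagram G t))) \<and>
       l2_norm (complex_laurent (loop_d ^ p * kauffman_bracket (twisted_diagram G t))) < C)"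
proof -
  let ?f = "\<lambda>t. loop_d ^ p * kauffman_bracket (twisted_diagram G t)"
  interpret plane_colored_graph G
    using assms(9,10) by unfold_locales (auto simp: colored_graph_of_def)
  have p: "p = max_tree_weight" using assms(11) by (simp add: max_tree_weight_def)
  have "p \<ge> 1"
    unfolding assms(11) using link_diagram_if_in_links[OF assms(1,2)] assms(3,5,8,9,10)
    by (rule max_tree_weight_pos)
  obtain B where B: "\<And>t. coeff_sum (?f t) \<le> B"
    using coeff_sum_bracket_bounded unfolding p by blast
  \<comment> \<open>Adding 1 makes the bound strict, and positive since \<open>B\<close> is
    nonnegative.\<close>
  have bound: "l2_norm (complex_laurent (?f t)) < of_int B + 1" for t
  proof -
    have "l2_norm (complex_laurent (?f t)) \<le> of_int (coeff_sum (?f t))" by (rule l2_norm_le_coeff_sum)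
    also have "\<dots> \<le> of_int B" using B by (simp only: of_int_le_iff)
    finally show ?thesis by simp
  qed
  have "B \<ge> 0" using order_trans[OF coeff_sum_nonneg B] .
  have "mahler_measure (complex_laurent (?f t)) < l2_norm (complex_laurent (?f t))" for t
  proof (rule mahler_measure_less_l2_norm)
    \<comment> \<open>The zero polynomial has Mahler measure 0, whereas d has Mahler measure
      1.\<close>
    have "loop_d \<noteq> 0" using mahler_measure_loop_d by (auto simp: mahler_measure_def)
    then show "?f t \<noteq> 0" using kauffman_bracket_neq_0 by simp
    show "int_eval (circle_point (1 / 8)) (?f t) = 0" using \<open>p \<ge> 1\<close> by (simp add: loop_d_zero)
  qed simp
  with bound \<open>B \<ge> 0\<close> show ?thesis
    by (intro exI[of _ "of_int B + 1"]) (simp add: mahler_measure_loop_d_power_mult)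
qed

end
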